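(* There are two notations $a,b\in\mathcal{O}$ with $|a|=|b|=\omega^2$ such that $\mathrm{Id}^{\dotplus a}$ and $\mathrm{Id}^{\dotplus b}$ are incomparable, i.e. $\mathrm{Id}^{\dotplus a}\not\le\mathrm{Id}^{\dotplus b}$ and $\mathrm{Id}^{\dotplus b}\not\le\mathrm{Id}^{\dotplus a}$.
   Context: All equivalence relations have domain $\omega$. $W_e$ denotes the $e$th c.e. set and $\phi_e$ the $e$th partial computable function. $E\le R$ means there is a total computable $f$ with $x\mathrel{E}y\Leftrightarrow f(x)\mathrel{R}f(y)$ for all $x,y$. $[S]_E$ is the $E$-closure of $S$. The jump $E^{\dotplus}$ is defined by $x\mathrel{E^{\dotplus}}y\Leftrightarrow [W_x]_E=[W_y]_E$. $\mathrm{Id}$ is the identity relation on $\omega$. $\mathcal{O}$ is Kleene's system of ordinal notations with order $<_{\mathcal O}$: $1$ denotes $0$; if $b$ denotes $\beta$ then $2^b$ denotes $\beta+1$; if $\phi_e$ is total with $\phi_e(n)<_{\mathcal O}\phi_e(n+1)$ for all $n$, then $3\cdot 5^e$ denotes $\sup_n|\phi_e(n)|$; $|a|$ is the ordinal denoted by $a$. For $a\in\mathcal O$ the iterated jump is defined by $E^{\dotplus 1}=E$ (here $1$ is the notation for $0$); $E^{\dotplus 2^b}=(E^{\dotplus b})^{\dotplus}$; $E^{\dotplus 3\cdot 5^e}=\oplus_i E^{\dotplus\phi_e(i)}$, where $\langle x,y\rangle\mathrel{\oplus_i E_i}\langle v,w\rangle$ iff $x=v$ and $y\mathrel{E_x}w$.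 *)

theory Defs
  imports Main "HOL-Library.Countable"
begin

unbundle cardinal_syntax

section \<open>Partial computable functions\<close>

text \<open>
  The partial computable functions are generated from the basic functions by pairing, composition,
  primitive recursion and unbounded search. All functions are unary; several arguments are passed
  through the Cantor pairing \<^const>\<open>prod_encode\<close>, a bijection.
\<close>

datatype code =
    Zero_code
  | Succ_code
  | Fst_code
  | Snd_code
  | Pair_code code code
  | Comp_code code code
  | Prec_code code code
  | Mu_code code

abbreviation npair :: "nat \<Rightarrow> nat \<Rightarrow> nat" where
  "npair x y \<equiv> prod_encode (x, y)"

abbreviation nfst :: "nat \<Rightarrow> nat" where
  "nfst z \<equiv> fst (prod_decode z)"

abbreviation nsnd :: "nat \<Rightarrow> nat" where
  "nsnd z \<equiv> snd (prod_decode z)"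

text \<open>
  \<open>None\<close> is divergence. On argument \<open>\<langle>x,n\<rangle>\<close>, \<open>Prec_code c d\<close> computes \<open>h(x,n)\<close> where \<open>h(x,0) = c(x)\<close>
  and \<open>h(x,m+1) = d\<langle>x,\<langle>m,h(x,m)\<rangle>\<rangle>\<close>. On argument \<open>x\<close>, \<open>Mu_code c\<close> computes the least \<open>n\<close> with
  \<open>c\<langle>x,n\<rangle> = 0\<close>, and diverges unless \<open>c\<langle>x,m\<rangle>\<close> converges for all \<open>m < n\<close>.
\<close>

primrec run :: "code \<Rightarrow> nat \<Rightarrow> nat option" where
  "run Zero_code x = Some 0"
| "run Succ_code x = Some (Suc x)"
| "run Fst_code x = Some (nfst x)"
| "run Snd_code x = Some (nsnd x)"
| "run (Pair_code c d) x =
     Option.bind (run c x) (\<lambda>u. Option.bind (run d x) (\<lambda>v. Some (npair u v)))"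
| "run (Comp_code c d) x = Option.bind (run d x) (run c)"
| "run (Prec_code c d) x =
     rec_nat (run c (nfst x))
       (\<lambda>m r. Option.bind r (\<lambda>v. run d (npair (nfst x) (npair m v))))
       (nsnd x)"
| "run (Mu_code c) x =
     (if \<exists>n. run c (npair x n) = Some 0 \<and> (\<forall>m<n. run c (npair x m) \<noteq> None)
      then Some (LEAST n. run c (npair x n) = Some 0) else None)"

lemma fst_prod_decode_le: "nfst n \<le> n"
  by (metis le_prod_encode_1 prod.collapse prod_decode_inverse)

lemma snd_prod_decode_le: "nsnd n \<le> n"
  by (metis le_prod_encode_2 prod.collapse prod_decode_inverse)

lemma decode_arg_less:
  assumes "n \<noteq> 0" "k = (n - 4) div 4"
  shows "nfst k < n" "nsnd k < n" "k < n"
proof -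
  show "k < n" using assms by linarith
  then show "nfst k < n" "nsnd k < n"
    using fst_prod_decode_le[of k] snd_prod_decode_le[of k] by linarith+
qed

text \<open>
  The numbers \<open>0,1,2,3\<close> are the indices of the four basic functions, and \<open>4 * k + r + 4\<close> with
  \<open>r < 4\<close> is an index for the \<open>r\<close>th construction applied to the codes with indices given by \<open>k\<close>.
\<close>

function decode :: "nat \<Rightarrow> code" where
  "decode n =
    (if n = 0 then Zero_code
     else if n = 1 then Succ_code
     else if n = 2 then Fst_code
     else if n = 3 then Snd_code
     else
       let k = (n - 4) div 4; r = (n - 4) mod 4 in
       if r = 0 then Pair_code (decode (nfst k)) (decode (nsnd k))
       else if r = 1 then Comp_code (decode (nfst k)) (decode (nsnd k))
       else if r = 2 then Prec_code (decode (nfst k)) (decode (nsnd k))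
       else Mu_code (decode k))"
  by pat_completeness auto
termination
  by (relation "measure id")
    (rule wf_measure, unfold in_measure id_apply, (rule decode_arg_less; assumption)+)

declare decode.simps [simp del]

lemma decode_base:
  "decode 0 = Zero_code" "decode 1 = Succ_code" "decode 2 = Fst_code" "decode 3 = Snd_code"
  by (subst decode.simps, simp)+

lemma decode_step:
  "decode (4 * npair i j + 4) = Pair_code (decode i) (decode j)"
  "decode (4 * npair i j + 5) = Comp_code (decode i) (decode j)"
  "decode (4 * npair i j + 6) = Prec_code (decode i) (decode j)"
  "decode (4 * k + 7) = Mu_code (decode k)"
proof -
  have *: "(4 * m + 1) div 4 = m" "(4 * m + 2) div 4 = m" "(4 * m + 3) div 4 = m"
    "(4 * m + 1) mod 4 = 1" "(4 * m + 2) mod 4 = 2" "(4 * m + 3) mod 4 = 3" for m :: nat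
    by presburger+
  have **: "4 * m + 5 - 4 = 4 * m + 1" "4 * m + 6 - 4 = 4 * m + 2" "4 * m + 7 - 4 = 4 * m + 3"
    for m :: nat by simp_all
  show "decode (4 * npair i j + 4) = Pair_code (decode i) (decode j)"
    by (subst decode.simps) simp
  show "decode (4 * npair i j + 5) = Comp_code (decode i) (decode j)"
    by (subst decode.simps) (simp only: ** * Let_def, simp)
  show "decode (4 * npair i j + 6) = Prec_code (decode i) (decode j)"
    by (subst decode.simps) (simp only: ** * Let_def, simp)
  show "decode (4 * k + 7) = Mu_code (decode k)"
    by (subst decode.simps) (simp only: ** * Let_def, simp)
qed

lemma decode_surj: "\<exists>e. decode e = c"
proof (induction c)
  case Zero_code show ?case using decode_base(1) by blast
next
  case Succ_code show ?case using decode_base(2) by blast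
next
  case Fst_code show ?case using decode_base(3) by blast
next
  case Snd_code show ?case using decode_base(4) by blast
next
  case (Pair_code c d) then show ?case using decode_step(1) by metis
next
  case (Comp_code c d) then show ?case using decode_step(2) by metis
next
  case (Prec_code c d) then show ?case using decode_step(3) by metis
next
  case (Mu_code c) then show ?case using decode_step(4) by metis
qed

definition phi :: "nat \<Rightarrow> nat \<Rightarrow> nat option" where
  "phi e = run (decode e)"

definition W :: "nat \<Rightarrow> nat set" where
  "W e = {x. phi e x \<noteq> None}"

definition computable :: "(nat \<Rightarrow> nat) \<Rightarrow> bool" where
  "computable f \<longleftrightarrow> (\<exists>e. \<forall>x. phi e x = Some (f x))"


section \<open>Relations on the natural numbers\<close>

definition reducible :: "nat rel \<Rightarrow> nat rel \<Rightarrow> bool"  (infix \<open>\<le>\<^sub>c\<close> 50) where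
  "E \<le>\<^sub>c R \<longleftrightarrow> (\<exists>f. computable f \<and> (\<forall>x y. (x, y) \<in> E \<longleftrightarrow> (f x, f y) \<in> R))"

text \<open>For an equivalence relation \<open>E\<close>, the \<open>E\<close>-closure of \<open>S\<close> is the relational image \<open>E `` S\<close>.\<close>

definition jump :: "nat rel \<Rightarrow> nat rel" where
  "jump E = {(x, y). E `` W x = E `` W y}"

definition direct_sum :: "(nat \<Rightarrow> nat rel) \<Rightarrow> nat rel" where
  "direct_sum E = {(npair x y, npair v w) | x y v w. x = v \<and> (y, w) \<in> E x}"

lemma equiv_jump: "equiv UNIV (jump E)"
  by (auto simp: equiv_def refl_on_def sym_def trans_def jump_def)


lemma equiv_direct_sum:
  assumes "\<And>i. equiv UNIV (E i)"
  shows "equiv UNIV (direct_sum E)"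
proof (rule equivI)
  have r: "(y, y) \<in> E x" for x y using assms[of x] by (auto simp: equiv_def refl_on_def)
  show "refl (direct_sum E)"
  proof (rule refl_onI)
    fix z
    have "(npair (nfst z) (nsnd z), npair (nfst z) (nsnd z)) \<in> direct_sum E"
      unfolding direct_sum_def using r by blast
    then show "(z, z) \<in> direct_sum E" by simp
  qed
  show "sym (direct_sum E)"
    using assms unfolding direct_sum_def equiv_def sym_def by blast
  show "trans (direct_sum E)"
    using assms unfolding direct_sum_def equiv_def trans_def by fastforce
qed simp


section \<open>Countable ordinals\<close>

text \<open>Order types of well-orders of sets of natural numbers.\<close>

quotient_type cord = "nat rel" / partial: "\<lambda>r s. r =o s"
proof (rule part_equivpI)
  show "\<exists>r :: nat rel. r =o r"
    using ordIso_reflexive[OF natLeq_Well_order] by blast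
  show "symp (\<lambda>r s :: nat rel. r =o s)"
    by (rule sympI) (rule ordIso_symmetric)
  show "transp (\<lambda>r s :: nat rel. r =o s)"
    by (rule transpI) (rule ordIso_transitive)
qed

lemma ordIso_self_iff: "r =o r \<longleftrightarrow> Well_order r"
  by (auto simp: ordIso_reflexive) (simp add: ordIso_def)

lemma cord_cases:
  obtains r where "Well_order r" "x = abs_cord r"
proof
  show "x = abs_cord (rep_cord x)"
    by (rule Quotient3_abs_rep[OF Quotient3_cord, symmetric])
  show "Well_order (rep_cord x)"
    using Quotient3_rep_reflp[OF Quotient3_cord] by (simp add: ordIso_self_iff)
qed

instantiation cord :: wellorder
begin

lift_definition less_eq_cord :: "cord \<Rightarrow> cord \<Rightarrow> bool" is "\<lambda>r s. r \<le>o s"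
  by (meson ordIso_ordLeq_trans ordIso_symmetric ordLeq_ordIso_trans)

lift_definition less_cord :: "cord \<Rightarrow> cord \<Rightarrow> bool" is "\<lambda>r s. r <o s"
  by (meson ordIso_ordLess_trans ordIso_symmetric ordLess_ordIso_trans)

instance
proof
  fix x y z :: cord
  show "x < y \<longleftrightarrow> x \<le> y \<and> \<not> y \<le> x"
    by transfer (meson ordIso_self_iff not_ordLeq_iff_ordLess ordLess_imp_ordLeq)
  show "x \<le> x"
    by transfer (simp add: ordIso_self_iff ordLeq_reflexive)
  show "x \<le> y \<Longrightarrow> y \<le> z \<Longrightarrow> x \<le> z"
    by transfer (rule ordLeq_transitive)
  show "x \<le> y \<Longrightarrow> y \<le> x \<Longrightarrow> x = y"
    by transfer (simp add: ordIso_iff_ordLeq)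
  show "x \<le> y \<or> y \<le> x"
    by transfer (simp add: ordIso_self_iff ordLeq_total)
next
  fix P :: "cord \<Rightarrow> bool" and a :: cord
  assume *: "\<And>x. (\<And>y. y < x \<Longrightarrow> P y) \<Longrightarrow> P x"
  have "P (abs_cord r)" if "Well_order r" for r
    using that
  proof (induction r rule: wf_induct_rule[OF wf_ordLess])
    case (1 r)
    show ?case
    proof (rule *)
      fix y assume "y < abs_cord r"
      then obtain s where s: "y = abs_cord s" "Well_order s"
        using cord_cases by blast
      then have "s <o r"
        using \<open>y < abs_cord r\<close> \<open>Well_order r\<close> by (simp add: less_cord.abs_eq ordIso_self_iff)
      then show "P y" using 1 s by simp
    qed
  qed
  then show "P a"
    using cord_cases[of a] by blast
qed

end

definition ord_zero :: cord where
  "ord_zero = (LEAST \<beta>. True)"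

definition ord_succ :: "cord \<Rightarrow> cord" where
  "ord_succ \<alpha> = (LEAST \<beta>. \<alpha> < \<beta>)"

definition ord_sup :: "(nat \<Rightarrow> cord) \<Rightarrow> cord" where
  "ord_sup \<alpha> = (LEAST \<beta>. \<forall>n. \<alpha> n \<le> \<beta>)"

text \<open>\<open>\<omega>\<^sup>2 = \<omega> \<cdot> \<omega>\<close> is the order type of the lexicographic order on pairs of natural numbers.\<close>

definition lex_nat :: "(nat \<times> nat) rel" where
  "lex_nat = {((m, n), (m', n')). m < m' \<or> m = m' \<and> n \<le> n'}"

definition omega_sq :: cord where
  "omega_sq = abs_cord (dir_image lex_nat prod_encode)"

lemma Well_order_lex_nat: "Well_order lex_nat"
proof -
  have F: "Field lex_nat = UNIV" by (auto simp: lex_nat_def Field_def)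
  have "lex_nat - Id = less_than <*lex*> less_than"
    by (auto simp: lex_nat_def)
  moreover have "wf (less_than <*lex*> less_than)" by (intro wf_lex_prod wf_less_than)
  ultimately have "wf (lex_nat - Id)" by simp
  then show ?thesis
    unfolding F by (auto simp: well_order_on_def linear_order_on_def partial_order_on_def preorder_on_def
        refl_on_def trans_def antisym_def total_on_def) (auto simp: lex_nat_def)
qed

lemma Well_order_omega_sq: "Well_order (dir_image lex_nat prod_encode)"
  by (rule Well_order_dir_image[OF Well_order_lex_nat]) (meson inj_prod_encode inj_on_subset subset_UNIV)

text \<open>
  The minima in the definitions of \<^const>\<open>ord_succ\<close> and \<^const>\<open>ord_sup\<close> are attained: every sequence
  of countable ordinals has a countable strict upper bound.
\<close>

lemma strict_mono_imp_ordLeq: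
  assumes r: "Well_order r" and s: "Well_order s"
    and f: "\<And>a b. (a, b) \<in> r \<Longrightarrow> a \<noteq> b \<Longrightarrow> (f a, f b) \<in> s \<and> f a \<noteq> f b"
    and fF: "\<And>a. a \<in> Field r \<Longrightarrow> f a \<in> Field s"
  shows "r \<le>o s"
proof (rule ccontr)
  assume "\<not> r \<le>o s"
  then have "s <o r" using r s not_ordLeq_iff_ordLess by blast
  then obtain a where a: "a \<in> Field r" "s =o Restr r (underS r a)"
    using ordLess_iff_ordIso_Restr[OF r s] by blast
  then obtain h where h: "iso s (Restr r (underS r a)) h"
    by (auto simp: ordIso_def)
  have h1: "(h x, h y) \<in> r \<and> h x \<noteq> h y" if "(x, y) \<in> s" "x \<noteq> y" for x y
  proof -
    have "inj_on h (Field s)" using h by (auto simp: iso_def bij_betw_def)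
    moreover have "(h x, h y) \<in> Restr r (underS r a)"
      using iso_forward[OF that(1) h] .
    ultimately show ?thesis using that by (auto simp: inj_on_def Field_def)
  qed
  have h2: "h x \<in> underS r a" if "x \<in> Field s" for x
  proof -
    have "h x \<in> Field (Restr r (underS r a))"
      using h that by (auto simp: iso_def bij_betw_def)
    then show ?thesis by (auto simp: Field_def)
  qed
  define k where "k = h \<circ> f"
  have k: "(k x, k y) \<in> r - Id" if "(x, y) \<in> r - Id" for x y
    using that f h1 unfolding k_def by auto
  have "wf (r - Id)" using r by (simp add: well_order_on_def)
  moreover have "a \<in> {z. (k z, z) \<in> r - Id}"
    using h2[OF fF[OF a(1)]] unfolding k_def underS_def by auto
  ultimately obtain z where z: "z \<in> {z. (k z, z) \<in> r - Id}"
      "\<And>y. (y, z) \<in> r - Id \<Longrightarrow> y \<notin> {z. (k z, z) \<in> r - Id}"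
    by (rule wfE_min) iprover
  have z1: "(k z, z) \<in> r - Id" using z(1) by simp
  from z(2)[OF z1] k[OF z1] show False by simp
qed

lemma Ex_strict_bound: "\<exists>\<beta>. \<forall>n. (\<alpha> :: nat \<Rightarrow> cord) n < \<beta>"
proof -
  have "\<exists>r. Well_order r \<and> \<alpha> n = abs_cord r" for n
    using cord_cases[of "\<alpha> n"] by blast
  then obtain r where r: "\<And>n. Well_order (r n)" and \<alpha>: "\<And>n. \<alpha> n = abs_cord (r n)"
    by metis
  \<comment> \<open>the sum of the \<open>r n\<close>, with a greatest element adjoined to each summand\<close>
  define q :: "nat \<Rightarrow> nat option rel" where
    "q n = {(Some x, Some y) | x y. (x, y) \<in> r n} \<union> (Some ` Field (r n) \<union> {None}) \<times> {None}" for n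
  define S where
    "S = {((i, x), (j, y)). x \<in> Field (q i) \<and> y \<in> Field (q j) \<and> (i < j \<or> i = j \<and> (x, y) \<in> q i)}"
  have Fq: "Field (q n) = Some ` Field (r n) \<union> {None}" for n
    by (auto simp: q_def Field_def)
  have r': "Refl (r n)" "trans (r n)" "antisym (r n)" "Total (r n)" "wf (r n - Id)" for n
    using r[of n] by (auto simp: well_order_on_def linear_order_on_def partial_order_on_def
        preorder_on_def)
  have q_refl: "Refl (q n)" for n
    using r'(1)[of n] unfolding refl_on_def Fq by (auto simp: q_def Field_def)
  have q_trans: "trans (q n)" for n
    using r'(2)[of n] unfolding trans_def by (auto simp: q_def Field_def)
  have q_antisym: "antisym (q n)" for n
    using r'(3)[of n] unfolding antisym_def by (auto simp: q_def)
  have q_total: "Total (q n)" for n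
    using r'(4)[of n] r'(1)[of n] unfolding total_on_def Fq by (auto simp: q_def)
  have q_wf: "wf (q n - Id)" for n
  proof (rule wfUNIVI)
    fix P x assume *: "\<forall>x. (\<forall>y. (y, x) \<in> q n - Id \<longrightarrow> P y) \<longrightarrow> P x"
    have some: "P (Some z)" for z
    proof (induction z rule: wf_induct_rule[OF r'(5)[of n]])
      case (1 z)
      show ?case by (rule *[rule_format]) (use 1 in \<open>auto simp: q_def\<close>)
    qed
    have "P None" by (rule *[rule_format]) (use some in \<open>auto simp: q_def\<close>)
    with some show "P x" by (cases x) auto
  qed
  have FS: "Field S = (SIGMA n:UNIV. Field (q n))"
  proof
    show "Field S \<subseteq> (SIGMA n:UNIV. Field (q n))"
      unfolding Field_def[of S] by (auto simp: S_def)
    show "(SIGMA n:UNIV. Field (q n)) \<subseteq> Field S"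
    proof
      fix p assume "p \<in> (SIGMA n:UNIV. Field (q n))"
      then have "(p, p) \<in> S" using q_refl by (auto simp: S_def refl_on_def)
      then show "p \<in> Field S" by (rule FieldI1)
    qed
  qed
  have S: "Well_order S"
  proof -
    have "Refl S" using q_refl unfolding refl_on_def FS by (auto simp: S_def)
    moreover have "S \<subseteq> Field S \<times> Field S" by (meson FieldI1 FieldI2 SigmaI subrelI)
    moreover have "trans S"
    proof (rule transI)
      fix u v w assume "(u, v) \<in> S" "(v, w) \<in> S"
      then show "(u, w) \<in> S"
        using transD[OF q_trans[of "fst u"], of "snd u" "snd v" "snd w"]
        by (cases u; cases v; cases w) (auto simp: S_def)
    qed
    moreover have "antisym S"
    proof (rule antisymI)
      fix u v assume "(u, v) \<in> S" "(v, u) \<in> S"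
      then show "u = v"
        using antisymD[OF q_antisym[of "fst u"], of "snd u" "snd v"]
        by (cases u; cases v) (auto simp: S_def)
    qed
    moreover have "Total S"
      unfolding total_on_def FS
    proof (intro ballI impI)
      fix u v
      assume *: "u \<in> (SIGMA n:UNIV. Field (q n))" "v \<in> (SIGMA n:UNIV. Field (q n))" "u \<noteq> v"
      then have "fst u = fst v \<Longrightarrow>
          (snd u, snd v) \<in> q (fst u) \<or> (snd v, snd u) \<in> q (fst u)"
        using q_total[of "fst u"] by (cases u; cases v) (simp add: total_on_def)
      then show "(u, v) \<in> S \<or> (v, u) \<in> S"
        using * by (cases u; cases v) (auto simp: S_def neq_iff)
    qed
    moreover have "wf (S - Id)"
    proof (rule wf_subset)
      show "wf (inv_image less_than fst \<union> {((i, x), (j, y)). i = j \<and> (x, y) \<in> q i - Id})"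
      proof (rule wfUNIVI)
        fix P :: "nat \<times> nat option \<Rightarrow> bool" and z
        assume *: "\<forall>z. (\<forall>y. (y, z) \<in> inv_image less_than fst \<union>
            {((i, x), (j, y)). i = j \<and> (x, y) \<in> q i - Id} \<longrightarrow> P y) \<longrightarrow> P z"
        have "\<forall>x. P (i, x)" for i
        proof (induction i rule: less_induct)
          case (less i)
          have "P (i, x)" for x
          proof (induction x rule: wf_induct_rule[OF q_wf[of i]])
            case (1 x)
            show ?case by (rule *[rule_format]) (use 1 less in auto)
          qed
          then show ?case by blast
        qed
        then show "P z" by (cases z) auto
      qed
    qed (auto simp: S_def)
    ultimately show ?thesis
      by (simp add: well_order_on_def linear_order_on_def partial_order_on_def preorder_on_def)
  qed
  have lt: "r n <o S" for n
  proof -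
    let ?t = "(n, None :: nat option)"
    have t: "?t \<in> Field S" by (simp add: FS Fq)
    let ?R = "Restr S (underS S ?t)"
    have R: "?R <o S" using underS_Restr_ordLess[OF S] t by blast
    have under: "(n, Some x) \<in> underS S ?t" if "x \<in> Field (r n)" for x
      using that unfolding underS_def S_def Fq by (auto simp: q_def)
    have in_R: "((n, Some x), (n, Some y)) \<in> ?R" if "(x, y) \<in> r n" for x y
      using that under FieldI1[OF that] FieldI2[OF that] unfolding S_def Fq by (auto simp: q_def)
    have "r n \<le>o ?R"
    proof (rule strict_mono_imp_ordLeq[where f = "\<lambda>x. (n, Some x)"])
      show "Well_order (r n)" by (rule r)
      show "Well_order ?R" using R by (simp add: ordLess_def)
      show "(n, Some a) \<in> Field ?R" if "a \<in> Field (r n)" for a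
        using in_R[of a a] that r'(1)[of n] by (auto simp: refl_on_def Field_def)
    qed (use in_R in auto)
    then show ?thesis using R by (rule ordLeq_ordLess_trans)
  qed
  define T where "T = dir_image S (\<lambda>p. to_nat p)"
  have "S =o T"
    unfolding T_def by (rule dir_image_ordIso[OF S]) (meson inj_to_nat inj_on_subset subset_UNIV)
  then have T: "Well_order T" by (simp add: ordIso_def)
  have "r n <o T" for n by (rule ordLess_ordIso_trans[OF lt \<open>S =o T\<close>])
  then have "\<alpha> n < abs_cord T" for n
    using r[of n] T by (simp add: \<alpha> less_cord.abs_eq ordIso_self_iff)
  then show ?thesis by blast
qed

lemma less_ord_succ: "\<alpha> < ord_succ \<alpha>"
proof -
  have "\<exists>\<beta>. \<alpha> < \<beta>" using Ex_strict_bound[of "\<lambda>_. \<alpha>"] by blast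
  then show ?thesis unfolding ord_succ_def by (rule LeastI_ex[of "\<lambda>\<beta>. \<alpha> < \<beta>"])
qed

lemma ord_succ_le_iff: "ord_succ \<alpha> \<le> \<beta> \<longleftrightarrow> \<alpha> < \<beta>"
proof
  assume "ord_succ \<alpha> \<le> \<beta>"
  with less_ord_succ show "\<alpha> < \<beta>" by (rule order_less_le_trans)
next
  assume "\<alpha> < \<beta>"
  then show "ord_succ \<alpha> \<le> \<beta>" unfolding ord_succ_def by (rule Least_le)
qed

lemma ord_sup_upper: "\<alpha> n \<le> ord_sup \<alpha>"
proof -
  have "\<exists>\<beta>. \<forall>n. \<alpha> n \<le> \<beta>" using Ex_strict_bound[of \<alpha>] by (meson less_imp_le)
  then have "\<forall>n. \<alpha> n \<le> ord_sup \<alpha>"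
    unfolding ord_sup_def by (rule LeastI_ex[of "\<lambda>\<beta>. \<forall>n. \<alpha> n \<le> \<beta>"])
  then show ?thesis ..
qed

lemma ord_sup_le_iff: "ord_sup \<alpha> \<le> \<beta> \<longleftrightarrow> (\<forall>n. \<alpha> n \<le> \<beta>)"
proof
  assume "ord_sup \<alpha> \<le> \<beta>"
  then show "\<forall>n. \<alpha> n \<le> \<beta>" using order_trans[OF ord_sup_upper] by simp
next
  assume "\<forall>n. \<alpha> n \<le> \<beta>"
  then show "ord_sup \<alpha> \<le> \<beta>" unfolding ord_sup_def by (rule Least_le)
qed


section \<open>Kleene's system of ordinal notations\<close>

inductive KO :: "nat \<Rightarrow> bool" and KO_less :: "nat \<Rightarrow> nat \<Rightarrow> bool"  (infix \<open><\<^sub>O\<close> 50) where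
  KO_one: "KO 1"
| KO_suc: "KO b \<Longrightarrow> KO (2 ^ b)"
| KO_lim: "\<lbrakk>\<And>n. phi e n = Some (f n); \<And>n. KO (f n); \<And>n. f n <\<^sub>O f (Suc n)\<rbrakk> \<Longrightarrow> KO (3 * 5 ^ e)"
| KO_less_suc: "KO b \<Longrightarrow> b <\<^sub>O 2 ^ b"
| KO_less_lim: "\<lbrakk>\<And>n. phi e n = Some (f n); \<And>n. KO (f n); \<And>n. f n <\<^sub>O f (Suc n)\<rbrakk>
    \<Longrightarrow> f n <\<^sub>O 3 * 5 ^ e"
| KO_less_trans: "\<lbrakk>a <\<^sub>O b; b <\<^sub>O c\<rbrakk> \<Longrightarrow> a <\<^sub>O c"

definition Kleene_O :: "nat set" where
  "Kleene_O = {a. KO a}"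

text \<open>
  Recursion on notations. \<open>KO_rec z s l a\<close> is the value at \<open>a\<close> of the function \<open>F\<close> on \<^const>\<open>Kleene_O\<close> with
  \<open>F 1 = z\<close>, \<open>F (2 ^ b) = s (F b)\<close> and \<open>F (3 * 5 ^ e) = l (\<lambda>n. F (\<phi>\<^sub>e n))\<close>; it is arbitrary outside
  \<^const>\<open>Kleene_O\<close>.
\<close>

inductive KO_rec_graph :: "'v \<Rightarrow> ('v \<Rightarrow> 'v) \<Rightarrow> ((nat \<Rightarrow> 'v) \<Rightarrow> 'v) \<Rightarrow> nat \<Rightarrow> 'v \<Rightarrow> bool"
  for z s l where
  "KO_rec_graph z s l 1 z"
| "KO_rec_graph z s l b v \<Longrightarrow> KO_rec_graph z s l (2 ^ b) (s v)"
| "\<lbrakk>\<And>n. phi e n = Some (f n); \<And>n. KO_rec_graph z s l (f n) (v n)\<rbrakk>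
    \<Longrightarrow> KO_rec_graph z s l (3 * 5 ^ e) (l v)"

definition KO_rec :: "'v \<Rightarrow> ('v \<Rightarrow> 'v) \<Rightarrow> ((nat \<Rightarrow> 'v) \<Rightarrow> 'v) \<Rightarrow> nat \<Rightarrow> 'v" where
  "KO_rec z s l a = (THE v. KO_rec_graph z s l a v)"

lemma pow2_neq_lim: "(2::nat) ^ b \<noteq> 3 * 5 ^ e" "3 * 5 ^ e \<noteq> (2::nat) ^ b"
proof -
  show "(2::nat) ^ b \<noteq> 3 * 5 ^ e"
  proof
    assume *: "(2::nat) ^ b = 3 * 5 ^ e"
    show False
    proof (cases b)
      case 0 with * show False by simp
    next
      case (Suc c)
      then have "even ((2::nat) ^ b)" by simp
      with * have "even (3 * 5 ^ e :: nat)" by simp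
      then show False by simp
    qed
  qed
  then show "3 * 5 ^ e \<noteq> (2::nat) ^ b" by metis
qed

lemma KO_rec_graph_pos: "KO_rec_graph z s l a v \<Longrightarrow> a > 0"
  by (induction rule: KO_rec_graph.induct) auto

lemma lim_neq_1: "3 * 5 ^ e \<noteq> (1::nat)" "1 \<noteq> (3 * 5 ^ e :: nat)"
  using pow2_neq_lim[of 0 e] by simp_all

lemma pow2_eq_1_iff: "(2::nat) ^ b = 1 \<longleftrightarrow> b = 0"
  using power_inject_exp[of "2::nat" b 0] by simp

lemma KO_rec_graph_unique:
  "KO_rec_graph z s l a v \<Longrightarrow> KO_rec_graph z s l a w \<Longrightarrow> v = w"
proof (induction arbitrary: w rule: KO_rec_graph.induct)
  case 1
  from 1 show ?case
  proof (cases rule: KO_rec_graph.cases)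
    case (2 b u)
    have "b = 0" using 2(1) pow2_eq_1_iff[of b] by metis
    then show ?thesis using KO_rec_graph_pos[OF 2(3)] by simp
  next
    case (3 e f u)
    then show ?thesis using lim_neq_1(2)[of e] by metis
  qed simp
next
  case (2 b v)
  have b: "b \<noteq> 0" using KO_rec_graph_pos[OF 2(1)] by simp
  from 2(3) show ?case
  proof (cases rule: KO_rec_graph.cases)
    case 1 then show ?thesis using b pow2_eq_1_iff[of b] by metis
  next
    case (2 b' u)
    then have "b' = b" by simp
    then have "v = u" using "2.IH"[of u] 2(3) by simp
    then show ?thesis using 2(2) by simp
  next
    case (3 e f u) then show ?thesis using pow2_neq_lim(1)[of b e] by metis
  qed
next
  case (3 e f v)
  from 3(4) show ?case
  proof (cases rule: KO_rec_graph.cases)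
    case 1 then show ?thesis using lim_neq_1(1)[of e] by metis
  next
    case (2 b u) then show ?thesis using pow2_neq_lim(1)[of b e] by metis
  next
    case (3 e' f' u)
    have "e' = e" using 3(1) by simp
    then have f: "f' n = f n" for n using 3(3)[of n] "3.hyps"(1)[of n] by simp
    have "v n = u n" for n by (rule "3.IH") (use 3(4)[of n] f in simp)
    then have "v = u" ..
    then show ?thesis using 3(2) by simp
  qed
qed

lemma KO_rec_graph_total: "KO a \<Longrightarrow> \<exists>v. KO_rec_graph z s l a v"
proof (induction a rule: KO_KO_less.inducts(1)[where ?P2.0 = "\<lambda>_ _. True"])
  case KO_one show ?case by (blast intro: KO_rec_graph.intros)
next
  case (KO_suc b) then show ?case by (blast intro: KO_rec_graph.intros)
next
  case (KO_lim e f)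
  then obtain v where "KO_rec_graph z s l (f n) (v n)" for n by metis
  with KO_lim show ?case using KO_rec_graph.intros(3)[of e f z s l v] by blast
qed simp_all

lemma KO_rec_graph_iff: "KO a \<Longrightarrow> KO_rec_graph z s l a v \<longleftrightarrow> KO_rec z s l a = v"
  unfolding KO_rec_def by (metis KO_rec_graph_total KO_rec_graph_unique the_equality)

lemma KO_rec_graph_KO_rec: "KO a \<Longrightarrow> KO_rec_graph z s l a (KO_rec z s l a)"
  by (simp add: KO_rec_graph_iff)

lemma KO_rec_1: "KO_rec z s l 1 = z"
  by (rule iffD1[OF KO_rec_graph_iff[OF KO_one] KO_rec_graph.intros(1)])

lemma KO_rec_suc: "KO b \<Longrightarrow> KO_rec z s l (2 ^ b) = s (KO_rec z s l b)"
  by (rule iffD1[OF KO_rec_graph_iff[OF KO_suc] KO_rec_graph.intros(2)[OF KO_rec_graph_KO_rec]])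

lemma KO_rec_lim:
  assumes "\<And>n. phi e n = Some (f n)" "\<And>n. KO (f n)" "\<And>n. f n <\<^sub>O f (Suc n)"
  shows "KO_rec z s l (3 * 5 ^ e) = l (\<lambda>n. KO_rec z s l (f n))"
proof -
  have "KO_rec_graph z s l (f n) (KO_rec z s l (f n))" for n
    by (rule KO_rec_graph_KO_rec[OF assms(2)])
  from KO_rec_graph.intros(3)[OF assms(1) this] show ?thesis
    by (simp only: KO_rec_graph_iff[OF KO_lim[OF assms]])
qed

definition ord_of :: "nat \<Rightarrow> cord" where
  "ord_of = KO_rec ord_zero ord_succ ord_sup"

definition iter_jump :: "nat rel \<Rightarrow> nat \<Rightarrow> nat rel" where
  "iter_jump E = KO_rec E jump direct_sum"

lemma ord_of_simps:
  "ord_of 1 = ord_zero"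
  "KO b \<Longrightarrow> ord_of (2 ^ b) = ord_succ (ord_of b)"
  "\<lbrakk>\<And>n. phi e n = Some (f n); \<And>n. KO (f n); \<And>n. f n <\<^sub>O f (Suc n)\<rbrakk>
    \<Longrightarrow> ord_of (3 * 5 ^ e) = ord_sup (\<lambda>n. ord_of (f n))"
  unfolding ord_of_def by (rule KO_rec_1, rule KO_rec_suc, assumption, rule KO_rec_lim)

lemma iter_jump_simps:
  "iter_jump E 1 = E"
  "KO b \<Longrightarrow> iter_jump E (2 ^ b) = jump (iter_jump E b)"
  "\<lbrakk>\<And>n. phi e n = Some (f n); \<And>n. KO (f n); \<And>n. f n <\<^sub>O f (Suc n)\<rbrakk>
    \<Longrightarrow> iter_jump E (3 * 5 ^ e) = direct_sum (\<lambda>n. iter_jump E (f n))"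
  unfolding iter_jump_def by (rule KO_rec_1, rule KO_rec_suc, assumption, rule KO_rec_lim)

lemma KO_less_imp_ord_less: "a <\<^sub>O b \<Longrightarrow> KO a \<and> KO b \<and> ord_of a < ord_of b"
proof (induction a b rule: KO_KO_less.inducts(2)[where ?P1.0 = KO])
  case (KO_less_suc b)
  then show ?case by (simp add: ord_of_simps KO_suc less_ord_succ)
next
  case (KO_less_lim e f n)
  have "ord_of (3 * 5 ^ e) = ord_sup (\<lambda>n. ord_of (f n))"
    by (rule ord_of_simps(3)) (use KO_less_lim in auto)
  moreover have "ord_of (f n) < ord_of (f (Suc n))" using KO_less_lim by blast
  moreover have "ord_of (f (Suc n)) \<le> ord_sup (\<lambda>n. ord_of (f n))"
    using ord_sup_upper[of "\<lambda>n. ord_of (f n)" "Suc n"] by simp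
  ultimately have "ord_of (f n) < ord_of (3 * 5 ^ e)" by (simp only: order_less_le_trans)
  then show ?case using KO_less_lim KO_lim[of e f] by auto
next
  case KO_one show ?case by (rule KO_KO_less.KO_one)
qed (auto intro: KO_suc KO_lim)

end

theory Submission
  imports Defs
begin

text \<open>
  The relation at a limit of jumps is a direct sum of jumps, and by Rice's theorem a reduction from it to another
  such sum sends whole columns to columns, along a computable function \<open>c\<close>. A column of height \<open>\<omega> \<cdot> g\<close>
  cannot reduce to one of height \<open>\<omega> \<cdot> h\<close> when \<open>2 * h < g\<close>: a set that is two-valued modulo \<open>E\<close> stays so,
  after finitely many jumps of \<open>E\<close>, under negation and quantification, so \<open>Id\<close> jumped \<open>\<omega> \<cdot> h\<close> times is itself
  coded in \<open>Id\<close> jumped \<open>\<omega> \<cdot> 2h\<close> times, and a reduction would contradict diagonalization.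
  It remains to find two sequences of notations whose heights \<open>g\<close> and \<open>h\<close> do not satisfy
  \<open>g i \<le> 2 * h (c i)\<close> for all \<open>i\<close>, or the same with \<open>g\<close> and \<open>h\<close> exchanged, for any computable \<open>c\<close>. The next limit of
  a notation may be raised by another \<open>\<omega>\<close> finitely often, whenever an event is observed, so the heights are only
  approximable from below and a finite injury argument provides them.
\<close>

section \<open>Closure properties of the computable functions\<close>

lemma computable_iff: "computable f \<longleftrightarrow> (\<exists>c. \<forall>x. run c x = Some (f x))"
  unfolding computable_def phi_def by (metis decode_surj)

definition decidable :: "(nat \<Rightarrow> bool) \<Rightarrow> bool" where
  "decidable P \<longleftrightarrow> computable (\<lambda>x. if P x then 1 else 0)"

lemma computable_id: "computable (\<lambda>x. x)"
  unfolding computable_iff by (rule exI[of _ "Pair_code Fst_code Snd_code"]) simp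

lemma computableI: "(\<And>x. run c x = Some (f x)) \<Longrightarrow> computable f"
  unfolding computable_iff by blast

lemma computableE:
  assumes "computable f" obtains c where "\<And>x. run c x = Some (f x)"
  using assms unfolding computable_iff by blast

lemma computable_comp:
  assumes "computable f" "computable g" shows "computable (\<lambda>x. f (g x))"
proof -
  obtain c d where "\<And>x. run c x = Some (f x)" "\<And>x. run d x = Some (g x)"
    using assms by (meson computableE)
  then show ?thesis by (intro computableI[of "Comp_code c d"]) simp
qed

lemma computable_const: "computable (\<lambda>x. c)"
proof (induction c)
  case 0
  show ?case unfolding computable_iff by (rule exI[of _ Zero_code]) simp
next
  case (Suc c)
  then obtain d where "\<forall>x. run d x = Some c" unfolding computable_iff by blast
  then show ?case unfolding computable_iff by (intro exI[of _ "Comp_code Succ_code d"]) simp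
qed

lemma computable_Suc: "computable f \<Longrightarrow> computable (\<lambda>x. Suc (f x))"
  by (rule computable_comp[OF computableI[of Succ_code]]) simp_all

lemma computable_nfst: "computable f \<Longrightarrow> computable (\<lambda>x. nfst (f x))"
  by (rule computable_comp[OF computableI[of Fst_code]]) simp_all

lemma computable_nsnd: "computable f \<Longrightarrow> computable (\<lambda>x. nsnd (f x))"
  by (rule computable_comp[OF computableI[of Snd_code]]) simp_all

lemma computable_npair:
  assumes "computable f" "computable g" shows "computable (\<lambda>x. npair (f x) (g x))"
proof -
  obtain c d where "\<And>x. run c x = Some (f x)" "\<And>x. run d x = Some (g x)"
    using assms by (meson computableE)
  then show ?thesis by (intro computableI[of "Pair_code c d"]) simp
qed

lemma computable_rec_nat:
  assumes "computable b" "computable (\<lambda>z. h (nfst z) (nfst (nsnd z)) (nsnd (nsnd z)))" "computable n"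
  shows "computable (\<lambda>x. rec_nat (b x) (\<lambda>m r. h x m r) (n x))"
proof -
  obtain cb ch where c: "\<And>x. run cb x = Some (b x)"
    "\<And>z. run ch z = Some (h (nfst z) (nfst (nsnd z)) (nsnd (nsnd z)))"
    using assms unfolding computable_iff by blast
  have "rec_nat (run cb x) (\<lambda>m r. Option.bind r (\<lambda>v. run ch (npair x (npair m v)))) k =
      Some (rec_nat (b x) (\<lambda>m r. h x m r) k)" for x k
    by (induction k) (simp_all add: c)
  then have "computable (\<lambda>z. rec_nat (b (nfst z)) (\<lambda>m r. h (nfst z) m r) (nsnd z))"
    unfolding computable_iff by (intro exI[of _ "Prec_code cb ch"]) simp
  from computable_comp[OF this computable_npair[OF computable_id assms(3)]] show ?thesis by simp
qed

lemma computable_plus: assumes "computable f" "computable g" shows "computable (\<lambda>x. f x + g x)"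
proof -
  have "rec_nat b (\<lambda>m r. Suc r) n = b + n" for b n by (induction n) auto
  then have "(\<lambda>x. f x + g x) = (\<lambda>x. rec_nat (f x) (\<lambda>m r. Suc r) (g x))" by auto
  then show ?thesis
    using assms by (simp only:) (intro computable_rec_nat computable_Suc computable_nsnd computable_id)
qed

lemma computable_times: assumes "computable f" "computable g" shows "computable (\<lambda>x. f x * g x)"
proof -
  have "rec_nat 0 (\<lambda>m r. r + b) n = n * b" for b n :: nat by (induction n) auto
  then have "(\<lambda>x. f x * g x) = (\<lambda>x. rec_nat 0 (\<lambda>m r. r + g x) (f x))" by auto
  moreover have "computable (\<lambda>x. rec_nat 0 (\<lambda>m r. r + g x) (f x))"
    by (intro computable_rec_nat computable_plus computable_nsnd computable_id computable_const
      assms computable_comp[OF assms(2)] computable_nfst)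
  ultimately show ?thesis by simp
qed

lemma computable_power: assumes "computable f" "computable g" shows "computable (\<lambda>x. f x ^ g x)"
proof -
  have "rec_nat 1 (\<lambda>m r. r * b) n = b ^ n" for b n :: nat by (induction n) auto
  then have "(\<lambda>x. f x ^ g x) = (\<lambda>x. rec_nat 1 (\<lambda>m r. r * f x) (g x))" by auto
  moreover have "computable (\<lambda>x. rec_nat 1 (\<lambda>m r. r * f x) (g x))"
    by (intro computable_rec_nat computable_times computable_nsnd computable_id computable_const
      assms computable_comp[OF assms(1)] computable_nfst)
  ultimately show ?thesis by simp
qed

lemma computable_minus: assumes "computable f" "computable g" shows "computable (\<lambda>x. f x - g x)"
proof -
  have "rec_nat 0 (\<lambda>m r. m) n = n - 1" for n by (cases n) auto
  then have "(\<lambda>x. x - 1) = (\<lambda>x. rec_nat 0 (\<lambda>m r. m) x)" by auto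
  moreover have "computable (\<lambda>x. rec_nat 0 (\<lambda>m r. m) x)"
    by (intro computable_rec_nat computable_const computable_nfst computable_nsnd computable_id)
  ultimately have pred: "computable (\<lambda>x. x - 1)" by simp
  have "rec_nat b (\<lambda>m r. r - 1) n = b - n" for b n :: nat by (induction n) auto
  then have "(\<lambda>x. f x - g x) = (\<lambda>x. rec_nat (f x) (\<lambda>m r. r - 1) (g x))" by auto
  moreover have "computable (\<lambda>x. rec_nat (f x) (\<lambda>m r. r - 1) (g x))"
    by (intro computable_rec_nat computable_comp[OF pred] computable_nsnd computable_id assms)
  ultimately show ?thesis by simp
qed

lemma computable_If:
  assumes "decidable P" "computable f" "computable g"
  shows "computable (\<lambda>x. if P x then f x else g x)"
proof -
  have "(\<lambda>x. if P x then f x else g x) =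
      (\<lambda>x. rec_nat (g x) (\<lambda>_ _. f x) (if P x then 1 else 0))" by auto
  moreover have "computable (\<lambda>x. rec_nat (g x) (\<lambda>_ _. f x) (if P x then 1 else 0))"
    by (intro computable_rec_nat assms computable_comp[OF assms(2)] computable_nfst computable_id
      assms(1)[unfolded decidable_def])
  ultimately show ?thesis by simp
qed

lemma decidable_comp: "decidable P \<Longrightarrow> computable g \<Longrightarrow> decidable (\<lambda>x. P (g x))"
  unfolding decidable_def by (rule computable_comp)

lemma decidable_const: "decidable (\<lambda>x. b)"
  unfolding decidable_def by (rule computable_const)

lemma decidable_le: assumes "computable f" "computable g" shows "decidable (\<lambda>x. f x \<le> g x)"
proof -
  have "(\<lambda>x. if f x \<le> g x then 1 else 0) = (\<lambda>x. 1 - (f x - g x))" by auto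
  then show ?thesis unfolding decidable_def
    by (simp only:) (intro computable_minus computable_const assms)
qed

lemma decidable_not: assumes "decidable P" shows "decidable (\<lambda>x. \<not> P x)"
proof -
  have "(\<lambda>x. if \<not> P x then 1 else 0 :: nat) = (\<lambda>x. if P x then 0 else 1)" by auto
  then show ?thesis unfolding decidable_def
    by (simp only:) (intro computable_If computable_const assms)
qed

lemma decidable_conj: assumes "decidable P" "decidable Q" shows "decidable (\<lambda>x. P x \<and> Q x)"
proof -
  have "(\<lambda>x. if P x \<and> Q x then 1 else 0 :: nat) = (\<lambda>x. if P x then if Q x then 1 else 0 else 0)" by auto
  then show ?thesis unfolding decidable_def
    by (simp only:) (intro computable_If computable_const assms)
qed

lemma decidable_disj: assumes "decidable P" "decidable Q" shows "decidable (\<lambda>x. P x \<or> Q x)"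
  using decidable_not[OF decidable_conj[OF decidable_not[OF assms(1)] decidable_not[OF assms(2)]]]
  by simp

lemma decidable_less: "computable f \<Longrightarrow> computable g \<Longrightarrow> decidable (\<lambda>x. f x < g x)"
  using decidable_not[OF decidable_le[of g f]] by (simp add: not_le)

lemma decidable_eq: "computable f \<Longrightarrow> computable g \<Longrightarrow> decidable (\<lambda>x. f x = g x)"
  using decidable_conj[OF decidable_le[of f g] decidable_le[of g f]] by (simp add: eq_iff)

lemma decidable_ex_less:
  assumes "decidable (\<lambda>z. P (nfst z) (nsnd z))" "computable b"
  shows "decidable (\<lambda>x. \<exists>v<b x. P x v)"
proof -
  have "rec_nat 0 (\<lambda>m r. if P x m then 1 else r) n = (if \<exists>v<n. P x v then 1 else 0::nat)" for n x
    by (induction n) (auto simp: less_Suc_eq)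
  then have "(\<lambda>x. if \<exists>v<b x. P x v then 1 else 0 :: nat) =
      (\<lambda>x. rec_nat 0 (\<lambda>m r. if P x m then 1 else r) (b x))" by simp
  moreover have "computable (\<lambda>z. if P (nfst z) (nfst (nsnd z)) then 1 else nsnd (nsnd z))"
    using decidable_comp[OF assms(1), of "\<lambda>z. npair (nfst z) (nfst (nsnd z))"]
    by (intro computable_If) (simp_all add: computable_npair computable_nfst computable_nsnd
        computable_id computable_const)
  ultimately show ?thesis unfolding decidable_def
    by (simp only:) (intro computable_rec_nat assms computable_const)
qed

lemma decidable_all_less:
  assumes "decidable (\<lambda>z. P (nfst z) (nsnd z))" "computable b"
  shows "decidable (\<lambda>x. \<forall>v<b x. P x v)"
  using decidable_not[OF decidable_ex_less[OF decidable_not[OF assms(1)] assms(2)]] by simp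

lemma computable_Least:
  assumes "decidable (\<lambda>z. P (nfst z) (nsnd z))" "\<And>x. \<exists>n. P x n"
  shows "computable (\<lambda>x. LEAST n. P x n)"
proof -
  obtain c where c: "run c z = Some (if P (nfst z) (nsnd z) then 0 else 1)" for z
    using computable_If[OF assms(1) computable_const[of 0] computable_const[of 1]]
    unfolding computable_iff by blast
  have "run (Mu_code c) x = Some (LEAST n. P x n)" for x
    using assms(2)[of x] by (simp add: c)
  then show ?thesis unfolding computable_iff by blast
qed

lemma computable_div: assumes "computable f" "computable g" shows "computable (\<lambda>x. f x div g x)"
proof -
  have "m div n = (LEAST q. n = 0 \<or> m < Suc q * n)" for m n :: nat
  proof (rule Least_equality[symmetric])
    show "n = 0 \<or> m < Suc (m div n) * n"
      using dividend_less_div_times[of n m] by (cases n) (auto simp: add.commute)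
    show "m div n \<le> q" if "n = 0 \<or> m < Suc q * n" for q
      using that less_mult_imp_div_less[of m "Suc q" n] by auto
  qed
  then have "(\<lambda>x. f x div g x) = (\<lambda>x. LEAST q. g x = 0 \<or> f x < Suc q * g x)" by simp
  moreover have "\<exists>q. g x = 0 \<or> f x < Suc q * g x" for x
    by (rule exI[of _ "f x"]) (cases "g x", auto)
  ultimately show ?thesis
    by (simp only:) (intro computable_Least decidable_disj decidable_eq decidable_less computable_times
      computable_Suc computable_nfst computable_nsnd computable_id computable_const
      computable_comp[OF assms(1)] computable_comp[OF assms(2)])
qed

lemma computable_mod: assumes "computable f" "computable g" shows "computable (\<lambda>x. f x mod g x)"
  using computable_minus[OF assms(1) computable_times[OF computable_div[OF assms] assms(2)]]
  by (simp add: minus_div_mult_eq_mod)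

lemma computable_funpow:
  assumes "computable f" "computable n" "computable b"
  shows "computable (\<lambda>x. (f ^^ n x) (b x))"
proof -
  have "rec_nat y (\<lambda>m r. f r) k = (f ^^ k) y" for y k by (induction k) auto
  then have "(\<lambda>x. (f ^^ n x) (b x)) = (\<lambda>x. rec_nat (b x) (\<lambda>m r. f r) (n x))" by simp
  then show ?thesis
    by (simp only:) (intro computable_rec_nat assms computable_comp[OF assms(1)] computable_nsnd
        computable_id)
qed

lemma computable_fun_upd:
  assumes "computable f" shows "computable (f(n := v))"
  unfolding fun_upd_def
  by (intro computable_If decidable_eq computable_const computable_id assms)

lemma decidable_odd: assumes "computable f" shows "decidable (\<lambda>x. odd (f x))"
  unfolding odd_iff_mod_2_eq_one
  by (intro decidable_eq computable_mod assms computable_const)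

lemma decidable_bit:
  assumes "computable f" "computable g" shows "decidable (\<lambda>x. bit (f x) (g x))"
  unfolding bit_iff_odd
  by (intro decidable_odd computable_div computable_power assms computable_const)

lemma computable_set_bit:
  assumes "computable f" "computable g" shows "computable (\<lambda>x. set_bit (g x) (f x :: nat))"
proof -
  have "(\<lambda>x. set_bit (g x) (f x)) = (\<lambda>x. if bit (f x) (g x) then f x else f x + 2 ^ g x)"
    by (auto simp: set_bit_eq)
  then show ?thesis
    by (simp only:) (intro computable_If decidable_bit computable_plus computable_power assms computable_const)
qed

lemmas computable_intros =
  computable_id computable_const computable_Suc computable_nfst computable_nsnd computable_npair
  computable_rec_nat computable_plus computable_times computable_power computable_minus computable_If
  computable_div computable_mod computable_set_bit
  decidable_const decidable_le decidable_not decidable_conj decidable_disj decidable_less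
  decidable_eq decidable_ex_less decidable_all_less decidable_bit decidable_odd

lemma smn: "\<exists>g. computable g \<and> (\<forall>n x. phi (g n) x = run c (npair n x))"
proof -
  define K where "K n = rec_nat 0 (\<lambda>_ k. 4 * npair 1 k + 5) n" for n :: nat
  have K: "run (decode (K n)) x = Some n" for n x
    by (induction n) (simp_all add: K_def decode_base decode_step[unfolded One_nat_def] del: One_nat_def)
  obtain e where e: "decode e = c" using decode_surj by blast
  define i where "i = 4 * npair 2 3 + 4"
  have i: "run (decode i) x = Some x" for x by (simp add: i_def decode_base decode_step)
  define g where "g n = 4 * npair e (4 * npair (K n) i + 4) + 5" for n
  have "phi (g n) x = run c (npair n x)" for n x
    by (simp add: phi_def g_def decode_step e K i)
  moreover have "computable g"
    unfolding g_def[abs_def] K_def by (intro computable_intros)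
  ultimately show ?thesis by blast
qed

lemma smn_total:
  assumes "computable (\<lambda>z. f (nfst z) (nsnd z))"
  shows "\<exists>g. computable g \<and> (\<forall>n x. phi (g n) x = Some (f n x))"
proof -
  obtain c where "\<And>z. run c z = Some (f (nfst z) (nsnd z))"
    using assms unfolding computable_iff by blast
  then show ?thesis using smn[of c] by simp
qed

lemma ce_index:
  assumes "decidable (\<lambda>z. P (nfst z) (nfst (nsnd z)) (nsnd (nsnd z)))"
  shows "\<exists>g. computable g \<and> (\<forall>n. W (g n) = {x. \<exists>s. P n x s})"
proof -
  have "computable (\<lambda>z. if P (nfst (nfst z)) (nsnd (nfst z)) (nsnd z) then 0 else 1)"
    using decidable_comp[OF assms, of "\<lambda>z. npair (nfst (nfst z)) (npair (nsnd (nfst z)) (nsnd z))"]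
    by (intro computable_intros) (simp add: computable_intros)
  then obtain c where c: "\<And>z. run c z =
      Some (if P (nfst (nfst z)) (nsnd (nfst z)) (nsnd z) then 0 else 1)"
    unfolding computable_iff by blast
  have *: "run (Mu_code c) (npair n x) \<noteq> None \<longleftrightarrow> (\<exists>s. P n x s)" for n x
    by (simp add: c)
  obtain g where "computable g" "\<And>n x. phi (g n) x = run (Mu_code c) (npair n x)"
    using smn[of "Mu_code c"] by blast
  then show ?thesis using * unfolding W_def by (intro exI[of _ g]) (simp del: run.simps)
qed


section \<open>Step-indexed evaluation\<close>

abbreviation fact_code :: "nat \<Rightarrow> nat \<Rightarrow> nat \<Rightarrow> nat" where
  "fact_code e x y \<equiv> npair e (npair x y)"

definition derivable :: "nat \<Rightarrow> nat \<Rightarrow> nat \<Rightarrow> nat \<Rightarrow> nat \<Rightarrow> bool" where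
  "derivable D s e x y \<longleftrightarrow>
    (let k = (e - 4) div 4; r = (e - 4) mod 4; i = nfst k; j = nsnd k in
      e = 0 \<and> y = 0 \<or> e = 1 \<and> y = Suc x \<or> e = 2 \<and> y = nfst x \<or> e = 3 \<and> y = nsnd x \<or>
      3 < e \<and>
       (r = 0 \<and> bit D (fact_code i x (nfst y)) \<and> bit D (fact_code j x (nsnd y)) \<or>
        r = 1 \<and> (\<exists>v<s. bit D (fact_code j x v) \<and> bit D (fact_code i v y)) \<or>
        r = 2 \<and> nsnd x = 0 \<and> bit D (fact_code i (nfst x) y) \<or>
        r = 2 \<and> 0 < nsnd x \<and>
          (\<exists>v<s. bit D (fact_code e (npair (nfst x) (nsnd x - 1)) v) \<and>
             bit D (fact_code j (npair (nfst x) (npair (nsnd x - 1) v)) y)) \<or>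
        r = 3 \<and> bit D (fact_code k (npair x y) 0) \<and>
          (\<forall>m<y. \<exists>v<s. 0 < v \<and> bit D (fact_code k (npair x m) v))))"

text \<open>\<open>derived s\<close> is, as a bit set, the set of facts \<open>phi e x = Some y\<close> found before stage \<open>s\<close>. Stage \<open>s\<close> tries
  the fact \<open>nfst s\<close>, so every fact is tried infinitely often.\<close>

primrec derived :: "nat \<Rightarrow> nat" where
  "derived 0 = 0"
| "derived (Suc s) =
    (if derivable (derived s) s (nfst (nfst s)) (nfst (nsnd (nfst s))) (nsnd (nsnd (nfst s)))
     then set_bit (nfst s) (derived s) else derived s)"

definition steps :: "nat \<Rightarrow> nat \<Rightarrow> nat \<Rightarrow> nat \<Rightarrow> bool" where
  "steps e x y s \<longleftrightarrow> bit (derived s) (fact_code e x y)"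

lemma decidable_derivable:
  assumes "computable D" "computable s" "computable e" "computable x" "computable y"
  shows "decidable (\<lambda>z. derivable (D z) (s z) (e z) (x z) (y z))"
proof -
  note comps = assms[THEN computable_comp]
  show ?thesis
    unfolding derivable_def Let_def
    by (intro computable_intros comps assms)
qed

lemma computable_derived: assumes "computable s" shows "computable (\<lambda>x. derived (s x))"
proof -
  have "derived n = rec_nat 0 (\<lambda>s D. if derivable D s (nfst (nfst s)) (nfst (nsnd (nfst s)))
      (nsnd (nsnd (nfst s))) then set_bit (nfst s) D else D) n" for n
    by (induction n) simp_all
  then show ?thesis
    by (simp only:) (intro computable_intros decidable_derivable assms)
qed

lemma decidable_steps:
  assumes "computable e" "computable x" "computable y" "computable s"
  shows "decidable (\<lambda>z. steps (e z) (x z) (y z) (s z))"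
  unfolding steps_def by (intro computable_intros computable_derived assms)

lemma bit_set_bit_nat: "bit (set_bit m (n :: nat)) k \<longleftrightarrow> bit n k \<or> k = m"
  by (auto simp: bit_set_bit_iff)

lemma steps_mono: "s \<le> s' \<Longrightarrow> steps e x y s \<Longrightarrow> steps e x y s'"
  by (induction s' rule: dec_induct) (auto simp: steps_def bit_set_bit_nat)

lemma steps_derivable:
  assumes "\<And>s. s1 \<le> s \<Longrightarrow> derivable (derived s) s e x y"
  shows "\<exists>s. steps e x y s"
proof -
  have "s1 \<le> npair (fact_code e x y) s1" by (rule le_prod_encode_2)
  then have "steps e x y (Suc (npair (fact_code e x y) s1))"
    using assms by (simp add: steps_def bit_set_bit_nat)
  then show ?thesis ..
qed

lemma ex_eventually_all:
  fixes P :: "nat \<Rightarrow> nat \<Rightarrow> bool"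
  assumes "\<forall>m<n. \<exists>s. \<forall>t\<ge>s. P m t"
  shows "\<exists>s. \<forall>t\<ge>s. \<forall>m<n. P m t"
  using assms
proof (induction n)
  case (Suc n)
  then obtain s s' where "\<forall>t\<ge>s. \<forall>m<n. P m t" "\<forall>t\<ge>s'. P n t" by auto
  then show ?case by (intro exI[of _ "max s s'"]) (auto simp: less_Suc_eq)
qed simp

lemma decode_cases:
  obtains "e = 0" "decode e = Zero_code" | "e = 1" "decode e = Succ_code"
  | "e = 2" "decode e = Fst_code" | "e = 3" "decode e = Snd_code"
  | k where "3 < e" "(e - 4) div 4 = k" "(e - 4) mod 4 = 0"
      "decode e = Pair_code (decode (nfst k)) (decode (nsnd k))"
  | k where "3 < e" "(e - 4) div 4 = k" "(e - 4) mod 4 = 1"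
      "decode e = Comp_code (decode (nfst k)) (decode (nsnd k))"
  | k where "3 < e" "(e - 4) div 4 = k" "(e - 4) mod 4 = 2"
      "decode e = Prec_code (decode (nfst k)) (decode (nsnd k))"
  | k where "3 < e" "(e - 4) div 4 = k" "(e - 4) mod 4 = 3" "decode e = Mu_code (decode k)"
proof -
  consider "e = 0" | "e = 1" | "e = 2" | "e = 3" | "3 < e" by linarith
  then show thesis
  proof cases
    case 5
    define k r where "k = (e - 4) div 4" and "r = (e - 4) mod 4"
    have "r < 4" by (simp add: r_def)
    then consider "r = 0" | "r = 1" | "r = 2" | "r = 3" by linarith
    moreover have e: "e = 4 * k + (r + 4)" using 5 by (simp add: k_def r_def)
    ultimately show thesis
    proof cases
      case 1
      show thesis using decode_step(1)[of "nfst k" "nsnd k"] 1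
        by (intro that(5)[OF 5 k_def[symmetric]]) (simp_all add: r_def[symmetric], simp add: e)
    next
      case 2
      show thesis using decode_step(2)[of "nfst k" "nsnd k"] 2
        by (intro that(6)[OF 5 k_def[symmetric]]) (simp_all add: r_def[symmetric], simp add: e)
    next
      case 3
      show thesis using decode_step(3)[of "nfst k" "nsnd k"] 3
        by (intro that(7)[OF 5 k_def[symmetric]]) (simp_all add: r_def[symmetric], simp add: e)
    next
      case 4
      show thesis using decode_step(4)[of k] 4
        by (intro that(8)[OF 5 k_def[symmetric]]) (simp_all add: r_def[symmetric], simp add: e)
    qed
  qed (use that decode_base in auto)
qed

lemma derivable_compound:
  assumes "3 < e" "(e - 4) div 4 = k"
  shows "(e - 4) mod 4 = 0 \<Longrightarrow> derivable D s e x y \<longleftrightarrow>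
      bit D (fact_code (nfst k) x (nfst y)) \<and> bit D (fact_code (nsnd k) x (nsnd y))"
    "(e - 4) mod 4 = 1 \<Longrightarrow> derivable D s e x y \<longleftrightarrow>
      (\<exists>v<s. bit D (fact_code (nsnd k) x v) \<and> bit D (fact_code (nfst k) v y))"
    "(e - 4) mod 4 = 2 \<Longrightarrow> derivable D s e (npair a 0) y \<longleftrightarrow> bit D (fact_code (nfst k) a y)"
    "(e - 4) mod 4 = 2 \<Longrightarrow> derivable D s e (npair a (Suc m)) y \<longleftrightarrow>
      (\<exists>v<s. bit D (fact_code e (npair a m) v) \<and> bit D (fact_code (nsnd k) (npair a (npair m v)) y))"
    "(e - 4) mod 4 = 3 \<Longrightarrow> derivable D s e x y \<longleftrightarrow>
      bit D (fact_code k (npair x y) 0) \<and>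
      (\<forall>m<y. \<exists>v<s. 0 < v \<and> bit D (fact_code k (npair x m) v))"
  using assms unfolding derivable_def Let_def by simp_all

lemma run_Prec_Suc:
  "run (Prec_code c d) (npair a (Suc m)) =
    Option.bind (run (Prec_code c d) (npair a m)) (\<lambda>v. run d (npair a (npair m v)))"
  by simp

lemma derivable_sound:
  assumes D: "\<And>e x y. bit D (fact_code e x y) \<Longrightarrow> phi e x = Some y" and d: "derivable D s e x y"
  shows "phi e x = Some y"
proof (cases e rule: decode_cases)
  case (5 k)
  then have "phi (nfst k) x = Some (nfst y)" "phi (nsnd k) x = Some (nsnd y)"
    using d D by (simp_all add: derivable_compound(1)[OF 5(1-3)])
  then show ?thesis by (simp add: phi_def 5)
next
  case (6 k)
  then obtain v where "phi (nsnd k) x = Some v" "phi (nfst k) v = Some y"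
    using d D by (auto simp: derivable_compound(2)[OF 6(1-3)])
  then show ?thesis by (simp add: phi_def 6)
next
  case (7 k)
  obtain a n where x: "x = npair a n" by (rule that[of "nfst x" "nsnd x"]) simp
  show ?thesis
  proof (cases n)
    case 0
    then have "phi (nfst k) a = Some y" using d D by (simp add: x 0 derivable_compound(3)[OF 7(1-3)])
    then show ?thesis by (simp add: phi_def 7 x 0)
  next
    case (Suc m)
    then obtain v where "phi e (npair a m) = Some v"
        "phi (nsnd k) (npair a (npair m v)) = Some y"
      using d D by (auto simp: x Suc derivable_compound(4)[OF 7(1-3)])
    then show ?thesis
      unfolding phi_def 7 x Suc run_Prec_Suc by (simp del: run.simps)
  qed
next
  case (8 k)
  have 1: "phi k (npair x y) = Some 0" using d D by (simp add: derivable_compound(5)[OF 8(1-3)])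
  have 2: "\<exists>v. 0 < v \<and> phi k (npair x m) = Some v" if "m < y" for m
    using d D that by (auto simp: derivable_compound(5)[OF 8(1-3)])
  have "(LEAST n. phi k (npair x n) = Some 0) = y"
  proof (rule Least_equality)
    show "y \<le> n" if "phi k (npair x n) = Some 0" for n
      using that 2[of n] by (cases "n < y") auto
  qed (rule 1)
  moreover have "\<exists>n. phi k (npair x n) = Some 0 \<and> (\<forall>m<n. phi k (npair x m) \<noteq> None)"
    using 1 2 by (intro exI[of _ y]) fastforce
  ultimately show ?thesis by (simp add: phi_def 8)
qed (use d in \<open>auto simp: derivable_def phi_def\<close>)

lemma steps_sound: "steps e x y s \<Longrightarrow> phi e x = Some y"
proof (induction s arbitrary: e x y)
  case 0
  then show ?case by (simp add: steps_def)
next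
  case (Suc s)
  show ?case
  proof (cases "steps e x y s")
    case True
    then show ?thesis by (rule Suc.IH)
  next
    case False
    then have f: "nfst s = fact_code e x y"
      using Suc.prems by (auto simp: steps_def bit_set_bit_nat split: if_splits)
    have "derivable (derived s) s e x y"
      using Suc.prems False by (simp add: steps_def f split: if_splits)
    then show ?thesis
      using derivable_sound[of "derived s"] Suc.IH unfolding steps_def by blast
  qed
qed

lemma steps_eventually: "\<exists>s. steps e x y s \<Longrightarrow> \<exists>s. \<forall>t\<ge>s. bit (derived t) (fact_code e x y)"
  using steps_mono unfolding steps_def by blast

lemma steps_complete: "phi e x = Some y \<Longrightarrow> \<exists>s. steps e x y s"
proof (induction e arbitrary: x y rule: less_induct)
  case (less e)
  show ?case
  proof (cases e rule: decode_cases)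
    case (5 k)
    have "e \<noteq> 0" using 5(1) by simp
    note lt = decode_arg_less[OF this 5(2)[symmetric]]
    obtain u v where "phi (nfst k) x = Some u" "phi (nsnd k) x = Some v" "y = npair u v"
      using less.prems by (auto simp: phi_def 5 bind_eq_Some_conv)
    then obtain s s' where
      "\<forall>t\<ge>s. bit (derived t) (fact_code (nfst k) x (nfst y))"
      "\<forall>t\<ge>s'. bit (derived t) (fact_code (nsnd k) x (nsnd y))"
      using steps_eventually[OF less.IH[OF lt(1)]] steps_eventually[OF less.IH[OF lt(2)]] that
      by (metis prod_encode_inverse fst_conv snd_conv)
    then show ?thesis
      by (intro steps_derivable[of "max s s'"]) (simp add: derivable_compound(1)[OF 5(1-3)])
  next
    case (6 k)
    have "e \<noteq> 0" using 6(1) by simp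
    note lt = decode_arg_less[OF this 6(2)[symmetric]]
    obtain v where "phi (nsnd k) x = Some v" "phi (nfst k) v = Some y"
      using less.prems by (auto simp: phi_def 6 bind_eq_Some_conv)
    then obtain s s' where
      "\<forall>t\<ge>s. bit (derived t) (fact_code (nsnd k) x v)"
      "\<forall>t\<ge>s'. bit (derived t) (fact_code (nfst k) v y)"
      using steps_eventually[OF less.IH[OF lt(1)]] steps_eventually[OF less.IH[OF lt(2)]] by blast
    then show ?thesis
      by (intro steps_derivable[of "Suc (max v (max s s'))"])
        (auto simp: derivable_compound(2)[OF 6(1-3)] intro!: exI[of _ v])
  next
    case (7 k)
    have "e \<noteq> 0" using 7(1) by simp
    note lt = decode_arg_less[OF this 7(2)[symmetric]]
    have "\<exists>s. steps e (npair a n) y s" if "phi e (npair a n) = Some y" for a n y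
      using that
    proof (induction n arbitrary: y)
      case 0
      then have "phi (nfst k) a = Some y" by (simp add: phi_def 7)
      then obtain s where "\<forall>t\<ge>s. bit (derived t) (fact_code (nfst k) a y)"
        using steps_eventually[OF less.IH[OF lt(1)]] by blast
      then show ?case by (intro steps_derivable[of s]) (simp add: derivable_compound(3)[OF 7(1-3)])
    next
      case (Suc n)
      obtain v where v: "phi e (npair a n) = Some v" "phi (nsnd k) (npair a (npair n v)) = Some y"
        using Suc.prems unfolding phi_def 7 run_Prec_Suc bind_eq_Some_conv by blast
      obtain s where "\<forall>t\<ge>s. bit (derived t) (fact_code e (npair a n) v)"
        using steps_eventually[OF Suc.IH[OF v(1)]] by auto
      moreover obtain s' where
        "\<forall>t\<ge>s'. bit (derived t) (fact_code (nsnd k) (npair a (npair n v)) y)"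
        using steps_eventually[OF less.IH[OF lt(2) v(2)]] by blast
      ultimately show ?case
        by (intro steps_derivable[of "Suc (max v (max s s'))"])
          (auto simp: derivable_compound(4)[OF 7(1-3)] intro!: exI[of _ v])
    qed
    from this[of "nfst x" "nsnd x"] show ?thesis using less.prems by simp
  next
    case (8 k)
    have "e \<noteq> 0" using 8(1) by simp
    note lt = decode_arg_less[OF this 8(2)[symmetric]]
    have *: "phi k (npair x y) = Some 0 \<and> (\<forall>m<y. \<exists>v. 0 < v \<and> phi k (npair x m) = Some v)"
    proof -
      obtain n where n: "phi k (npair x n) = Some 0" "\<And>m. m < n \<Longrightarrow> phi k (npair x m) \<noteq> None"
        and y: "y = (LEAST n. phi k (npair x n) = Some 0)"
        using less.prems by (auto simp: phi_def 8 split: if_splits)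
      have "phi k (npair x y) = Some 0" unfolding y using n(1) by (rule LeastI)
      moreover have "\<exists>v. 0 < v \<and> phi k (npair x m) = Some v" if "m < y" for m
      proof -
        have "phi k (npair x m) \<noteq> Some 0" using not_less_Least that unfolding y by blast
        moreover have "y \<le> n" unfolding y using n(1) by (rule Least_le)
        ultimately show ?thesis using n(2)[of m] that by (cases "phi k (npair x m)") auto
      qed
      ultimately show ?thesis by blast
    qed
    obtain s where s: "\<forall>t\<ge>s. bit (derived t) (fact_code k (npair x y) 0)"
      using steps_eventually[OF less.IH[OF lt(3)]] * by blast
    have "\<exists>s. \<forall>t\<ge>s. \<exists>v<t. 0 < v \<and> bit (derived t) (fact_code k (npair x m) v)" if "m < y" for m
    proof -
      obtain v where v: "0 < v" "phi k (npair x m) = Some v" using * \<open>m < y\<close> by blast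
      then obtain s where "\<forall>t\<ge>s. bit (derived t) (fact_code k (npair x m) v)"
        using steps_eventually[OF less.IH[OF lt(3) v(2)]] by blast
      then show ?thesis using v
        by (intro exI[of _ "Suc (max v s)"]) (auto simp: less_Suc_eq_le intro!: exI[of _ v])
    qed
    then obtain s' where
      "\<forall>t\<ge>s'. \<forall>m<y. \<exists>v<t. 0 < v \<and> bit (derived t) (fact_code k (npair x m) v)"
      using ex_eventually_all[of y "\<lambda>m t. \<exists>v<t. 0 < v \<and> bit (derived t) (fact_code k (npair x m) v)"]
      by blast
    then show ?thesis using s
      by (intro steps_derivable[of "max s s'"]) (simp add: derivable_compound(5)[OF 8(1-3)])
  qed (use less.prems in \<open>auto intro!: steps_derivable[of 0] simp: derivable_def phi_def\<close>)
qed

lemma phi_eq_Some_iff: "phi e x = Some y \<longleftrightarrow> (\<exists>s. steps e x y s)"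
  using steps_sound steps_complete by blast

lemma in_W_iff: "x \<in> W e \<longleftrightarrow> (\<exists>y s. steps e x y s)"
  unfolding W_def by (simp add: phi_eq_Some_iff[symmetric])

lemma ex_steps_iff: "(\<exists>s. steps e x (nfst s) (nsnd s)) \<longleftrightarrow> x \<in> W e"
  unfolding in_W_iff by (metis prod_encode_inverse fst_conv snd_conv)


section \<open>Sets coded in an equivalence relation\<close>

definition smn_fun :: "(nat \<Rightarrow> nat \<Rightarrow> nat) \<Rightarrow> nat \<Rightarrow> nat" where
  "smn_fun f = (SOME g. computable g \<and> (\<forall>n x. phi (g n) x = Some (f n x)))"

lemma smn_fun:
  assumes "computable (\<lambda>z. f (nfst z) (nsnd z))"
  shows "computable (smn_fun f)" "phi (smn_fun f n) x = Some (f n x)"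
  using someI_ex[OF smn_total[of f, OF assms]] unfolding smn_fun_def by blast+

definition ce_fun :: "(nat \<Rightarrow> nat \<Rightarrow> nat \<Rightarrow> bool) \<Rightarrow> nat \<Rightarrow> nat" where
  "ce_fun P = (SOME g. computable g \<and> (\<forall>n. W (g n) = {x. \<exists>s. P n x s}))"

lemma ce_fun:
  assumes "decidable (\<lambda>z. P (nfst z) (nfst (nsnd z)) (nsnd (nsnd z)))"
  shows "computable (ce_fun P)" "W (ce_fun P n) = {x. \<exists>s. P n x s}"
  using someI_ex[OF ce_index[of P, OF assms]] unfolding ce_fun_def by blast+

definition ins :: "nat \<Rightarrow> nat \<Rightarrow> nat" where
  "ins x a = ce_fun (\<lambda>n z s. z = nfst n \<or> steps (nsnd n) z (nfst s) (nsnd s)) (npair x a)"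

lemma computable_ins: assumes "computable f" "computable g" shows "computable (\<lambda>x. ins (f x) (g x))"
  unfolding ins_def
  by (intro computable_comp[OF ce_fun(1)] computable_intros decidable_steps assms)

lemma W_ins: "W (ins x a) = insert x (W a)"
  unfolding ins_def
  by (subst ce_fun(2)) (auto simp: ex_disj_distrib ex_steps_iff intro!: computable_intros decidable_steps)

definition emp :: nat where
  "emp = ce_fun (\<lambda>_ _ _. False) 0"

lemma W_emp: "W emp = {}"
  unfolding emp_def by (subst ce_fun(2)) (auto intro!: computable_intros)

definition img :: "nat \<Rightarrow> nat \<Rightarrow> nat" where
  "img e a = ce_fun (\<lambda>n z s. steps (nsnd n) (nfst s) (nfst (nsnd s)) (nfst (nsnd (nsnd s))) \<and>
     steps (nfst n) (nfst s) z (nsnd (nsnd (nsnd s)))) (npair e a)"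

lemma computable_img: assumes "computable f" "computable g" shows "computable (\<lambda>x. img (f x) (g x))"
  unfolding img_def
  by (intro computable_comp[OF ce_fun(1)] computable_intros decidable_steps assms)

lemma W_img: "W (img e a) = {y. \<exists>m\<in>W a. phi e m = Some y}"
proof -
  have "(\<exists>s. steps a (nfst s) (nfst (nsnd s)) (nfst (nsnd (nsnd s))) \<and>
     steps e (nfst s) z (nsnd (nsnd (nsnd s)))) \<longleftrightarrow> (\<exists>m\<in>W a. phi e m = Some z)" (is "?L = ?R") for z
  proof
    show "?L \<Longrightarrow> ?R" unfolding Bex_def in_W_iff phi_eq_Some_iff by blast
    assume ?R
    then obtain m y s s' where "steps a m y s" "steps e m z s'"
      unfolding Bex_def in_W_iff phi_eq_Some_iff by blast
    then show ?L by (intro exI[of _ "npair m (npair y (npair s s'))"]) simp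
  qed
  then show ?thesis
    unfolding img_def by (subst ce_fun(2)) (auto intro!: computable_intros decidable_steps)
qed


lemma equivD:
  assumes "equiv UNIV F"
  shows "(x, x) \<in> F" "(x, y) \<in> F \<Longrightarrow> (y, x) \<in> F" "(x, y) \<in> F \<Longrightarrow> (y, z) \<in> F \<Longrightarrow> (x, z) \<in> F"
  using assms unfolding equiv_def refl_on_def by (blast dest: symD transD)+

lemma jump_iff:
  assumes "equiv UNIV F"
  shows "(x, y) \<in> jump F \<longleftrightarrow>
    (\<forall>u\<in>W x. \<exists>v\<in>W y. (u, v) \<in> F) \<and> (\<forall>v\<in>W y. \<exists>u\<in>W x. (u, v) \<in> F)"
proof
  assume "(x, y) \<in> jump F"
  then have eq: "F `` W x = F `` W y" by (simp add: jump_def)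
  have "\<exists>v\<in>W y. (u, v) \<in> F" if "u \<in> W x" for u
    using that eq equivD(1,2)[OF assms] by (metis ImageE ImageI)
  moreover have "\<exists>u\<in>W x. (u, v) \<in> F" if "v \<in> W y" for v
    using that eq equivD(1)[OF assms] by (metis ImageE ImageI)
  ultimately show "(\<forall>u\<in>W x. \<exists>v\<in>W y. (u, v) \<in> F) \<and> (\<forall>v\<in>W y. \<exists>u\<in>W x. (u, v) \<in> F)" by blast
next
  assume *: "(\<forall>u\<in>W x. \<exists>v\<in>W y. (u, v) \<in> F) \<and> (\<forall>v\<in>W y. \<exists>u\<in>W x. (u, v) \<in> F)"
  have "F `` W x = F `` W y"
  proof (intro equalityI subsetI)
    fix z assume "z \<in> F `` W x"
    then show "z \<in> F `` W y" using * equivD(2,3)[OF assms] by (meson ImageE ImageI)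
  next
    fix z assume "z \<in> F `` W y"
    then show "z \<in> F `` W x" using * equivD(2,3)[OF assms] by (meson ImageE ImageI)
  qed
  then show "(x, y) \<in> jump F" by (simp add: jump_def)
qed

lemma jump_ins:
  assumes "equiv UNIV F" "(a, b) \<in> F" "(x, y) \<in> jump F"
  shows "(ins a x, ins b y) \<in> jump F"
  using assms(2,3) unfolding jump_iff[OF assms(1)] W_ins by blast

lemma jump_refl: "(x, x) \<in> jump F"
  by (simp add: jump_def)

lemma jump_W_eq: "W x = W y \<Longrightarrow> (x, y) \<in> jump F"
  by (simp add: jump_def)

lemma equiv_jump_funpow: "equiv UNIV F \<Longrightarrow> equiv UNIV ((jump ^^ n) F)"
  by (cases n) (simp_all add: equiv_jump)

lemma reducible_refl: "E \<le>\<^sub>c E"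
  unfolding reducible_def using computable_id by (intro exI[of _ "\<lambda>x. x"]) simp

lemma reducible_trans:
  assumes "E \<le>\<^sub>c F" "F \<le>\<^sub>c G" shows "E \<le>\<^sub>c G"
proof -
  obtain f g where "computable f" "\<And>x y. (x, y) \<in> E \<longleftrightarrow> (f x, f y) \<in> F"
    "computable g" "\<And>x y. (x, y) \<in> F \<longleftrightarrow> (g x, g y) \<in> G"
    using assms unfolding reducible_def by blast
  then show ?thesis unfolding reducible_def
    by (intro exI[of _ "\<lambda>x. g (f x)"]) (simp add: computable_comp)
qed

abbreviation sing :: "nat \<Rightarrow> nat" where
  "sing x \<equiv> ins x emp"

lemma computable_sing: "computable f \<Longrightarrow> computable (\<lambda>x. sing (f x))"
  by (intro computable_ins computable_const)

lemma jump_sing_iff: "equiv UNIV F \<Longrightarrow> (sing x, sing y) \<in> jump F \<longleftrightarrow> (x, y) \<in> F"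
  by (auto simp: jump_iff W_ins W_emp)

lemma jump_funpow_sing_iff:
  "equiv UNIV F \<Longrightarrow> ((sing ^^ n) x, (sing ^^ n) y) \<in> (jump ^^ n) F \<longleftrightarrow> (x, y) \<in> F"
  by (induction n) (simp_all add: jump_sing_iff equiv_jump_funpow)

lemma jump_funpow_sing_iff':
  assumes "equiv UNIV F"
  shows "((sing ^^ n) x, (sing ^^ n) y) \<in> (jump ^^ (n + m)) F \<longleftrightarrow> (x, y) \<in> (jump ^^ m) F"
  using jump_funpow_sing_iff[OF equiv_jump_funpow[OF assms, of m], of n x y]
  by (simp add: funpow_add)

lemma reducible_jump_funpow:
  assumes "equiv UNIV F" "m \<le> n" shows "(jump ^^ m) F \<le>\<^sub>c (jump ^^ n) F"
  unfolding reducible_def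
  using jump_funpow_sing_iff'[OF assms(1), of "n - m" _ _ m] assms(2)
    computable_funpow[OF computable_sing[OF computable_id] computable_const computable_id]
  by (intro exI[of _ "\<lambda>x. (sing ^^ (n - m)) x"]) simp

lemma direct_sum_iff:
  "(x, y) \<in> direct_sum E \<longleftrightarrow> nfst x = nfst y \<and> (nsnd x, nsnd y) \<in> E (nfst x)"
proof
  assume *: "nfst x = nfst y \<and> (nsnd x, nsnd y) \<in> E (nfst x)"
  have "x = npair (nfst x) (nsnd x)" "y = npair (nfst y) (nsnd y)" by simp_all
  with * show "(x, y) \<in> direct_sum E" unfolding direct_sum_def by blast
qed (auto simp: direct_sum_def)

lemma reducible_direct_sum: "E n \<le>\<^sub>c direct_sum E"
  unfolding reducible_def
  by (intro exI[of _ "\<lambda>x. npair n x"]) (simp add: direct_sum_iff computable_intros)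


text \<open>A code \<open>c = \<langle>e, \<langle>s, t\<rangle>\<rangle>\<close> of \<open>A\<close> consists of two inequivalent constants \<open>s\<close> (false) and \<open>t\<close> (true) and the index \<open>e\<close>
  of a computable function into their classes. The constants change from code to code.\<close>

definition codes :: "nat rel \<Rightarrow> nat set \<Rightarrow> nat \<Rightarrow> bool" where
  "codes F A c \<longleftrightarrow> (nfst (nsnd c), nsnd (nsnd c)) \<notin> F \<and>
    (\<forall>n. \<exists>y. phi (nfst c) n = Some y \<and> (y, if n \<in> A then nsnd (nsnd c) else nfst (nsnd c)) \<in> F)"

definition coded :: "nat rel \<Rightarrow> nat set \<Rightarrow> bool" where
  "coded F A \<longleftrightarrow> (\<exists>c. codes F A c)"

lemma coded_iff:
  "coded F A \<longleftrightarrow> (\<exists>p s t. computable p \<and> (s, t) \<notin> F \<and> (\<forall>n. (p n, if n \<in> A then t else s) \<in> F))"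
proof
  assume "coded F A"
  then obtain c where c: "(nfst (nsnd c), nsnd (nsnd c)) \<notin> F" and
    "\<forall>n. \<exists>y. phi (nfst c) n = Some y \<and> (y, if n \<in> A then nsnd (nsnd c) else nfst (nsnd c)) \<in> F"
    unfolding coded_def codes_def by blast
  then obtain p where "\<And>n. phi (nfst c) n = Some (p n)"
    "\<And>n. (p n, if n \<in> A then nsnd (nsnd c) else nfst (nsnd c)) \<in> F"
    by metis
  with c show "\<exists>p s t. computable p \<and> (s, t) \<notin> F \<and> (\<forall>n. (p n, if n \<in> A then t else s) \<in> F)"
    unfolding computable_def by blast
next
  assume "\<exists>p s t. computable p \<and> (s, t) \<notin> F \<and> (\<forall>n. (p n, if n \<in> A then t else s) \<in> F)"
  then obtain p s t e where "(s, t) \<notin> F" "\<And>n. (p n, if n \<in> A then t else s) \<in> F"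
    "\<And>n. phi e n = Some (p n)"
    unfolding computable_def by blast
  then show "coded F A"
    unfolding coded_def codes_def by (intro exI[of _ "npair e (npair s t)"]) (simp cong: if_cong split del: if_split)
qed

lemma coded_mono:
  assumes "coded F A" "F \<le>\<^sub>c F'" shows "coded F' A"
proof -
  obtain p s t f where *: "computable p" "(s, t) \<notin> F" "\<And>n. (p n, if n \<in> A then t else s) \<in> F"
    "computable f" "\<And>x y. (x, y) \<in> F \<longleftrightarrow> (f x, f y) \<in> F'"
    using assms unfolding coded_iff reducible_def by blast
  have "(f (p n), if n \<in> A then f t else f s) \<in> F'" for n
    using *(3)[of n] *(5) by (auto split: if_splits)
  with * show ?thesis unfolding coded_iff
    by (intro exI[of _ "\<lambda>x. f (p x)"] exI[of _ "f s"] exI[of _ "f t"]) (simp add: computable_comp)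
qed

lemma coded_preimage:
  assumes "coded F A" "computable g" shows "coded F {n. g n \<in> A}"
proof -
  obtain p s t where *: "computable p" "(s, t) \<notin> F" "\<And>n. (p n, if n \<in> A then t else s) \<in> F"
    using assms unfolding coded_iff by blast
  then show ?thesis unfolding coded_iff
    by (intro exI[of _ "\<lambda>x. p (g x)"] exI[of _ s] exI[of _ t]) (simp add: computable_comp assms(2))
qed

lemma coded_Int_decidable:
  assumes "equiv UNIV F" "coded F A" "decidable D" shows "coded F {n. D n \<and> n \<in> A}"
proof -
  obtain p s t where *: "computable p" "(s, t) \<notin> F" "\<And>n. (p n, if n \<in> A then t else s) \<in> F"
    using assms unfolding coded_iff by blast
  have "(if D n then p n else s, if D n \<and> n \<in> A then t else s) \<in> F" for n
    using *(3)[of n] equivD(1)[OF assms(1)] by (cases "D n"; cases "n \<in> A") simp_all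
  with * show ?thesis unfolding coded_iff
    by (intro exI[of _ "\<lambda>n. if D n then p n else s"] exI[of _ s] exI[of _ t])
      (simp add: computable_intros assms(3))
qed

lemma coded_decidable:
  assumes "equiv UNIV F" "(s, t) \<notin> F" "decidable D" shows "coded F {n. D n}"
  using assms equivD(1)[OF assms(1)] unfolding coded_iff
  by (intro exI[of _ "\<lambda>n. if D n then t else s"] exI[of _ s] exI[of _ t])
    (simp add: computable_intros)

definition precomp :: "(nat \<Rightarrow> nat) \<Rightarrow> nat \<Rightarrow> nat" where
  "precomp g c = npair (4 * npair (nfst c) (SOME i. \<forall>x. phi i x = Some (g x)) + 5) (nsnd c)"

lemma computable_precomp: "computable (precomp g)"
  unfolding precomp_def[abs_def] by (intro computable_intros)

lemma codes_precomp:
  assumes "codes F A c" "computable g" shows "codes F {n. g n \<in> A} (precomp g c)"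
proof -
  have "phi (SOME i. \<forall>x. phi i x = Some (g x)) x = Some (g x)" for x
    using someI_ex[OF assms(2)[unfolded computable_def]] by blast
  then have "phi (nfst (precomp g c)) n = phi (nfst c) (g n)" for n
    unfolding precomp_def by (simp add: phi_def decode_step)
  moreover have "nsnd (precomp g c) = nsnd c" by (simp add: precomp_def)
  ultimately show ?thesis using assms(1) unfolding codes_def by (simp cong: if_cong split del: if_split)
qed


definition nor :: "nat set \<Rightarrow> nat set" where
  "nor A = {n. W n \<inter> A = {}}"

text \<open>
  With \<open>S = {s}\<close> and \<open>T = {s, t}\<close>, the set \<open>{s} \<union> {p m | m \<in> W n}\<close> is \<open>S\<close> or \<open>T\<close>. As a map of \<open>x\<close>,
  \<open>{{S}, {T}, {x, T}}\<close> distinguishes \<open>S\<close> from \<open>T\<close>; which of the two outcomes is called true is then a free choice,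
  and the negation costs nothing.
\<close>

definition nor_val :: "nat \<Rightarrow> nat \<Rightarrow> nat \<Rightarrow> nat" where
  "nor_val s t x = (let S = sing s; T = ins s (sing t) in
     ins (sing S) (ins (sing T) (sing (ins x (sing T)))))"

definition nor_code :: "nat \<Rightarrow> nat" where
  "nor_code c = (let s = nfst (nsnd c); t = nsnd (nsnd c) in
     npair (smn_fun (\<lambda>c n. nor_val (nfst (nsnd c)) (nsnd (nsnd c)) (ins (nfst (nsnd c)) (img (nfst c) n))) c)
       (npair (nor_val s t (ins s (sing t))) (nor_val s t (sing s))))"

lemma computable_nor_val:
  assumes "computable s" "computable t" "computable x"
  shows "computable (\<lambda>n. nor_val (s n) (t n) (x n))"
  unfolding nor_val_def Let_def by (intro computable_ins computable_const assms)

lemma computable_nor_code: "computable nor_code"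
  unfolding nor_code_def[abs_def] Let_def
  by (intro computable_intros smn_fun(1)[THEN computable_comp] computable_nor_val computable_ins
    computable_img)

lemma codes_nor_code:
  assumes F: "equiv UNIV F" and c: "codes F A c"
  shows "codes (jump (jump (jump F))) (nor A) (nor_code c)"
proof -
  define e s t where "e = nfst c" and "s = nfst (nsnd c)" and "t = nsnd (nsnd c)"
  note F1 = equiv_jump[of F] and F2 = equiv_jump[of "jump F"]
  let ?S = "sing s" and ?T = "ins s (sing t)"
  have st: "(s, t) \<notin> F" and phi: "\<And>n. \<exists>y. phi e n = Some y \<and> (y, if n \<in> A then t else s) \<in> F"
    using c unfolding codes_def e_def s_def t_def by auto
  have ST: "(?S, ?T) \<notin> jump F"
    using st by (simp add: jump_iff[OF F] W_ins W_emp)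
  have e': "phi (nfst (nor_code c)) n = Some (nor_val s t (ins s (img e n)))" for n
    unfolding nor_code_def Let_def e_def s_def t_def
    by (simp, subst smn_fun(2)) (auto intro!: computable_intros computable_nor_val computable_ins computable_img)
  have nsnd: "nsnd (nor_code c) = npair (nor_val s t ?T) (nor_val s t ?S)"
    unfolding nor_code_def Let_def s_def t_def by simp
  have cong: "(nor_val s t x, nor_val s t y) \<in> jump (jump (jump F))" if "(x, y) \<in> jump F" for x y
    unfolding nor_val_def Let_def
    by (intro jump_ins F1 F2 jump_refl that)
  have "(nor_val s t ?T, nor_val s t ?S) \<notin> jump (jump (jump F))"
  proof
    assume "(nor_val s t ?T, nor_val s t ?S) \<in> jump (jump (jump F))"
    then have "\<exists>u\<in>{sing ?S, sing ?T, ins ?T (sing ?T)}. (u, ins ?S (sing ?T)) \<in> jump (jump F)"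
      unfolding nor_val_def Let_def by (auto simp: jump_iff[OF F2] W_ins W_emp)
    moreover have "(?T, ?S) \<notin> jump F" using ST equivD(2)[OF F1] by blast
    ultimately show False using ST by (auto simp: jump_iff[OF F1] W_ins W_emp)
  qed
  moreover have "(nor_val s t (ins s (img e n)), if n \<in> nor A then nor_val s t ?S else nor_val s t ?T)
      \<in> jump (jump (jump F))" for n
  proof (cases "n \<in> nor A")
    case True
    have "(y, s) \<in> F" if "m \<in> W n" "phi e m = Some y" for m y
      using phi[of m] that True by (auto simp: nor_def split: if_splits)
    then have "(ins s (img e n), ?S) \<in> jump F"
      using equivD(1)[OF F] by (auto simp: jump_iff[OF F] W_ins W_emp W_img)
    then show ?thesis using True cong by simp
  next
    case False
    then obtain m where m: "m \<in> W n" "m \<in> A" by (auto simp: nor_def)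
    have "(y, s) \<in> F \<or> (y, t) \<in> F" if "phi e m = Some y" for m y
      using phi[of m] that by (auto split: if_splits)
    moreover obtain y where "phi e m = Some y" "(y, t) \<in> F" using phi[of m] m by auto
    ultimately have "(ins s (img e n), ?T) \<in> jump F"
      using equivD(1)[OF F] m by (auto simp: jump_iff[OF F] W_ins W_emp W_img)
    then show ?thesis using False cong by simp
  qed
  ultimately show ?thesis
    unfolding codes_def nsnd e' by (simp cong: if_cong split del: if_split)
qed

definition pairs :: "nat rel \<Rightarrow> nat set" where
  "pairs R = {z. (nfst z, nsnd z) \<in> R}"

text \<open>The set coded by the inner \<open>nor_code\<close> is \<open>{\<langle>y, u\<rangle>. no v in W y is R-equivalent to u}\<close>.\<close>

definition jump_code :: "nat \<Rightarrow> nat" where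
  "jump_code c =
    precomp (ce_fun (\<lambda>n z s. nfst z = nsnd n \<and> steps (nfst n) (nsnd z) (nfst s) (nsnd s) \<or>
       nfst z = nfst n \<and> steps (nsnd n) (nsnd z) (nfst s) (nsnd s)))
     (nor_code (precomp (ce_fun (\<lambda>n z s. nfst z = nsnd n \<and> steps (nfst n) (nsnd z) (nfst s) (nsnd s)))
       (nor_code c)))"

lemma computable_jump_code: "computable jump_code"
  unfolding jump_code_def[abs_def]
  by (intro computable_comp[OF computable_precomp] computable_comp[OF computable_nor_code] computable_id)

lemma ex_npair_in_Un:
  "(\<exists>q\<in>{z. nfst z = b \<and> nsnd z \<in> M \<or> nfst z = a \<and> nsnd z \<in> N}. q \<in> B) \<longleftrightarrow>
    (\<exists>u\<in>M. npair b u \<in> B) \<or> (\<exists>u\<in>N. npair a u \<in> B)" (is "?L \<longleftrightarrow> ?R")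
proof
  show "?L \<Longrightarrow> ?R" by (auto intro!: bexI)
  assume ?R
  then show ?L
  proof (elim disjE bexE)
    show ?L if "u \<in> M" "npair b u \<in> B" for u using that by (intro bexI[of _ "npair b u"]) simp_all
    show ?L if "u \<in> N" "npair a u \<in> B" for u using that by (intro bexI[of _ "npair a u"]) simp_all
  qed
qed

lemma codes_jump_code:
  assumes F: "equiv UNIV F" and R: "equiv UNIV R" and c: "codes F (pairs R) c"
  shows "codes ((jump ^^ 6) F) (pairs (jump R)) (jump_code c)"
proof -
  let ?P = "\<lambda>n z s. nfst z = nsnd n \<and> steps (nfst n) (nsnd z) (nfst s) (nsnd s)"
  let ?Q = "\<lambda>n z s. nfst z = nsnd n \<and> steps (nfst n) (nsnd z) (nfst s) (nsnd s) \<or>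
       nfst z = nfst n \<and> steps (nsnd n) (nsnd z) (nfst s) (nsnd s)"
  have P: "decidable (\<lambda>z. ?P (nfst z) (nfst (nsnd z)) (nsnd (nsnd z)))"
    by (intro computable_intros decidable_steps)
  have Q: "decidable (\<lambda>z. ?Q (nfst z) (nfst (nsnd z)) (nsnd (nsnd z)))"
    by (intro computable_intros decidable_steps)
  let ?B = "{n. ce_fun ?P n \<in> nor (pairs R)}"
  have "codes (jump (jump (jump F))) ?B (precomp (ce_fun ?P) (nor_code c))"
    by (intro codes_precomp codes_nor_code assms ce_fun(1) P)
  from codes_nor_code[OF equiv_jump this]
  have "codes ((jump ^^ 6) F) {n. ce_fun ?Q n \<in> nor ?B} (jump_code c)"
    unfolding jump_code_def by (intro codes_precomp ce_fun(1) Q) (simp add: numeral_eq_Suc)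
  moreover have "{n. ce_fun ?Q n \<in> nor ?B} = pairs (jump R)"
  proof -
    have WP: "W (ce_fun ?P n) = {z. nfst z = nsnd n \<and> nsnd z \<in> W (nfst n)}" for n
      by (subst ce_fun(2)[of ?P, OF P]) (auto simp: ex_steps_iff)
    have WQ: "W (ce_fun ?Q n) = {z. nfst z = nsnd n \<and> nsnd z \<in> W (nfst n) \<or>
        nfst z = nfst n \<and> nsnd z \<in> W (nsnd n)}" for n
      by (subst ce_fun(2)[of ?Q, OF Q]) (auto simp: ex_disj_distrib ex_steps_iff)
    have B: "z \<in> ?B \<longleftrightarrow> \<not> (\<exists>v\<in>W (nfst z). (nsnd z, v) \<in> R)" for z
    proof -
      have "(\<exists>v\<in>W (nfst z). (nsnd z, v) \<in> R) \<longleftrightarrow> (\<exists>q\<in>W (ce_fun ?P z). q \<in> pairs R)"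
        unfolding WP using ex_npair_in_Un[of "nsnd z" "W (nfst z)" _ "{}" "pairs R"]
        by (simp add: pairs_def)
      then show ?thesis unfolding nor_def by blast
    qed
    have "ce_fun ?Q n \<in> nor ?B \<longleftrightarrow> (nfst n, nsnd n) \<in> jump R" for n
    proof -
      have "ce_fun ?Q n \<notin> nor ?B \<longleftrightarrow> (\<exists>q\<in>W (ce_fun ?Q n). q \<in> ?B)"
        unfolding nor_def[of ?B] by blast
      also have "\<dots> \<longleftrightarrow> (\<exists>u\<in>W (nfst n). npair (nsnd n) u \<in> ?B) \<or> (\<exists>u\<in>W (nsnd n). npair (nfst n) u \<in> ?B)"
        unfolding WQ by (rule ex_npair_in_Un)
      also have "\<dots> \<longleftrightarrow> \<not> ((\<forall>u\<in>W (nfst n). \<exists>v\<in>W (nsnd n). (u, v) \<in> R) \<and>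
          (\<forall>u\<in>W (nsnd n). \<exists>v\<in>W (nfst n). (u, v) \<in> R))"
        unfolding B by simp
      also have "\<dots> \<longleftrightarrow> (nfst n, nsnd n) \<notin> jump R"
        unfolding jump_iff[OF R] using equivD(2)[OF R] by blast
      finally show ?thesis by blast
    qed
    then show ?thesis by (simp add: pairs_def)
  qed
  ultimately show ?thesis by simp
qed

lemma codes_jump_code_funpow:
  assumes F: "equiv UNIV F" and R: "equiv UNIV R" and c: "codes F (pairs R) c"
  shows "codes ((jump ^^ (6 * n)) F) (pairs ((jump ^^ n) R)) ((jump_code ^^ n) c)"
proof (induction n)
  case (Suc n)
  have "codes ((jump ^^ 6) ((jump ^^ (6 * n)) F)) (pairs (jump ((jump ^^ n) R))) (jump_code ((jump_code ^^ n) c))"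
    by (intro codes_jump_code equiv_jump_funpow F R Suc)
  moreover have "(jump ^^ 6) ((jump ^^ (6 * n)) F) = (jump ^^ (6 * Suc n)) F"
    by (simp flip: funpow_add[THEN fun_cong, unfolded comp_apply])
  ultimately show ?case by simp
qed (use c in simp)

text \<open>Here each column has its own constants \<open>s i\<close> and \<open>t i\<close>. They become common constants two jumps up: \<open>Q\<close> is equivalent
  to \<open>V\<close>, the set of all \<open>t j\<close>, if the answer is true, and to \<open>U i\<close>, where \<open>t i\<close> is replaced by \<open>s i\<close>, otherwise. Adding
  all \<open>U j\<close> to \<open>{Q}\<close> hides the dependence on \<open>i\<close>.\<close>

lemma coded_direct_sum:
  assumes F': "equiv UNIV F'" and F: "\<And>i. equiv UNIV (F i)"
    and emb: "computable emb"
      "\<And>i j x y. (emb (npair i x), emb (npair j y)) \<in> F' \<longleftrightarrow> i = j \<and> (x, y) \<in> F i"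
    and c: "computable c" "\<And>i. codes (F i) (A i) (c i)"
  shows "coded (jump (jump F')) {z. nsnd z \<in> A (nfst z)}"
proof -
  define e s t where "e i = nfst (c i)" and "s i = nfst (nsnd (c i))" and "t i = nsnd (nsnd (c i))" for i
  have comp: "computable e" "computable s" "computable t"
    unfolding e_def[abs_def] s_def[abs_def] t_def[abs_def] by (intro computable_intros c)+
  note comps = computable_intros emb(1) comp emb(1)[THEN computable_comp] comp[THEN computable_comp]
    decidable_steps
  have st: "(s i, t i) \<notin> F i" and
    phi: "\<And>n. \<exists>y. phi (e i) n = Some y \<and> (y, if n \<in> A i then t i else s i) \<in> F i" for i
    using c(2)[of i] unfolding codes_def e_def s_def t_def by auto
  have ts: "(t i, s i) \<notin> F i" for i using st equivD(2)[OF F] by blast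
  define tt where "tt j = emb (npair j (t j))" for j
  have tt: "computable tt" unfolding tt_def[abs_def] by (intro comps)
  note comps = comps tt tt[THEN computable_comp]
  define Q where "Q = ce_fun (\<lambda>n z q. steps (e (nfst n)) (nsnd n) (nfst q) (nsnd q) \<and>
      z = emb (npair (nfst n) (nfst q)) \<or> q \<noteq> nfst n \<and> z = tt q)"
  define U where "U = ce_fun (\<lambda>n z q. z = emb (npair n (s n)) \<or> q \<noteq> n \<and> z = tt q)"
  define V where "V = ce_fun (\<lambda>n z q. z = tt q) 0"
  define X where "X = ce_fun (\<lambda>n z q. z = U q) 0"
  have dQ: "computable Q" unfolding Q_def by (intro ce_fun(1) comps)
  have dU: "computable U" unfolding U_def by (intro ce_fun(1) comps)
  have WQ: "W (Q n) = {emb (npair (nfst n) y) | y. phi (e (nfst n)) (nsnd n) = Some y} \<union> tt ` (- {nfst n})" for n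
  proof -
    have "W (Q n) = {z. \<exists>q. steps (e (nfst n)) (nsnd n) (nfst q) (nsnd q) \<and>
      z = emb (npair (nfst n) (nfst q)) \<or> q \<noteq> nfst n \<and> z = tt q}"
      unfolding Q_def by (subst ce_fun(2)) (intro comps, simp)
    moreover have "(\<exists>q. steps a b (nfst q) (nsnd q) \<and> z = emb (npair k (nfst q))) \<longleftrightarrow>
      (\<exists>y. phi a b = Some y \<and> z = emb (npair k y))" for a b k z
      unfolding phi_eq_Some_iff by (metis prod_encode_inverse fst_conv snd_conv)
    ultimately show ?thesis by (auto simp: ex_disj_distrib)
  qed
  have WU: "W (U n) = insert (emb (npair n (s n))) (tt ` (- {n}))" for n
    unfolding U_def by (subst ce_fun(2)) (intro comps, auto)
  have WV: "W V = range tt"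
    unfolding V_def by (subst ce_fun(2)) (intro comps, auto)
  have WX: "W X = range U"
    unfolding X_def by (subst ce_fun(2)) (intro comps dU computable_comp[OF dU], auto)
  have VU: "(V, U j) \<notin> jump F'" for j
    using ts by (auto simp: jump_iff[OF F'] WU WV tt_def emb(2))
  have "(X, ins V X) \<notin> jump (jump F')"
    using VU equivD(2)[OF equiv_jump[of F']] by (auto simp: jump_iff[OF equiv_jump] W_ins WX)
  moreover have "(ins (Q n) X, if nsnd n \<in> A (nfst n) then ins V X else X) \<in> jump (jump F')" for n
  proof -
    obtain y where y: "phi (e (nfst n)) (nsnd n) = Some y"
      "(y, if nsnd n \<in> A (nfst n) then t (nfst n) else s (nfst n)) \<in> F (nfst n)"
      using phi[of "nfst n" "nsnd n"] by blast
    have WQ': "W (Q n) = insert (emb (npair (nfst n) y)) (tt ` (- {nfst n}))"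
      by (simp add: WQ y(1))
    show ?thesis
    proof (cases "nsnd n \<in> A (nfst n)")
      case True
      have "range tt = insert (emb (npair (nfst n) (t (nfst n)))) (tt ` (- {nfst n}))"
        unfolding tt_def by auto
      then have "(Q n, V) \<in> jump F'"
        using y(2) True equivD(1)[OF F'] by (auto simp: jump_iff[OF F'] WQ' WV emb(2))
      then show ?thesis using True by (simp add: jump_ins equiv_jump jump_refl)
    next
      case False
      then have "(Q n, U (nfst n)) \<in> jump F'"
        using y(2) equivD(1)[OF F'] by (auto simp: jump_iff[OF F'] WQ' WU emb(2))
      then show ?thesis using False by (auto simp: jump_iff[OF equiv_jump] W_ins WX intro: jump_refl)
    qed
  qed
  ultimately show ?thesis unfolding coded_iff
    by (intro exI[of _ "\<lambda>n. ins (Q n) X"] exI[of _ X] exI[of _ "ins V X"])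
      (simp add: computable_ins dQ computable_const)
qed

lemma not_coded_of_reducible:
  assumes E: "equiv UNIV E" and F: "equiv UNIV F" and red: "(jump ^^ 3) F \<le>\<^sub>c E"
  shows "\<not> coded F (pairs E)"
proof
  assume "coded F (pairs E)"
  then have "coded (jump (jump (jump F))) (nor (pairs E))"
    using codes_nor_code[OF F] unfolding coded_def by blast
  then have "coded E (nor (pairs E))"
    by (rule coded_mono) (use red in \<open>simp add: numeral_3_eq_3\<close>)
  then obtain p s t where p: "computable p" "(s, t) \<notin> E"
    "\<And>n. (p n, if n \<in> nor (pairs E) then t else s) \<in> E"
    unfolding coded_iff by blast
  let ?P = "\<lambda>n z q. nsnd z = t \<and> steps n n (nfst z) q"
  have P: "decidable (\<lambda>z. ?P (nfst z) (nfst (nsnd z)) (nsnd (nsnd z)))"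
    by (intro computable_intros decidable_steps)
  have W: "W (ce_fun ?P n) = {z. nsnd z = t \<and> phi n n = Some (nfst z)}" for n
    unfolding ce_fun(2)[of ?P, OF P] phi_eq_Some_iff by blast
  have nor: "ce_fun ?P n \<in> nor (pairs E) \<longleftrightarrow> \<not> (\<exists>y. phi n n = Some y \<and> (y, t) \<in> E)" for n
  proof -
    have "(\<exists>y. phi n n = Some y \<and> (y, t) \<in> E) \<longleftrightarrow> (\<exists>q\<in>W (ce_fun ?P n). q \<in> pairs E)" (is "?L \<longleftrightarrow> ?R")
    proof
      assume ?L
      then obtain y where "phi n n = Some y" "(y, t) \<in> E" by blast
      then show ?R unfolding W pairs_def by (intro bexI[of _ "npair y t"]) simp_all
    next
      assume ?R
      then obtain q where "nsnd q = t" "phi n n = Some (nfst q)" "(nfst q, nsnd q) \<in> E"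
        unfolding W pairs_def by blast
      then show ?L by blast
    qed
    then show ?thesis unfolding nor_def by blast
  qed
  obtain e where "phi e x = Some (p (ce_fun ?P x))" for x
    using computable_comp[OF p(1) ce_fun(1)[of ?P, OF P]] unfolding computable_def by blast
  then have "(p (ce_fun ?P e), t) \<in> E \<longleftrightarrow> ce_fun ?P e \<notin> nor (pairs E)" by (simp add: nor)
  moreover have "(p n, t) \<in> E \<longleftrightarrow> n \<in> nor (pairs E)" for n
  proof (cases "n \<in> nor (pairs E)")
    case True
    then show ?thesis using p(3)[of n] by simp
  next
    case False
    then have "(s, p n) \<in> E" using p(3)[of n] equivD(2)[OF E] by simp
    then have "(p n, t) \<notin> E" using p(2) equivD(3)[OF E] by blast
    then show ?thesis using False by blast
  qed
  ultimately show False by blast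
qed

lemma Rice_constant:
  assumes c: "computable c" "\<And>x y. W x = W y \<Longrightarrow> c x = c y"
  shows "c x = c y"
proof -
  have "c x = c emp" for x
  proof (rule ccontr)
    assume *: "c x \<noteq> c emp"
    let ?P = "\<lambda>n z q. steps n n (nfst q) (nfst (nsnd q)) \<and>
      steps x z (nfst (nsnd (nsnd q))) (nsnd (nsnd (nsnd q)))"
    have P: "decidable (\<lambda>z. ?P (nfst z) (nfst (nsnd z)) (nsnd (nsnd z)))"
      by (intro computable_intros decidable_steps)
    have "(\<exists>q. ?P n z q) \<longleftrightarrow> n \<in> W n \<and> z \<in> W x" (is "?L = ?R") for n z
    proof
      show "?L \<Longrightarrow> ?R" unfolding in_W_iff by blast
      assume ?R
      then obtain y s y' s' where "steps n n y s" "steps x z y' s'" unfolding in_W_iff by blast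
      then show ?L by (intro exI[of _ "npair y (npair s (npair y' s'))"]) simp
    qed
    then have W: "W (ce_fun ?P n) = (if n \<in> W n then W x else {})" for n
      unfolding ce_fun(2)[of ?P, OF P] by auto
    have ceq: "c (ce_fun ?P n) = (if n \<in> W n then c x else c emp)" for n
      using c(2)[of "ce_fun ?P n" x] c(2)[of "ce_fun ?P n" emp] W[of n] by (auto simp: W_emp)
    have D: "decidable (\<lambda>z. c (ce_fun ?P (nfst (nsnd z))) = c emp)"
      by (intro computable_intros c(1)[THEN computable_comp] ce_fun(1)[of ?P, OF P, THEN computable_comp])
    let ?Q = "\<lambda>n z q :: nat. c (ce_fun ?P z) = c emp"
    have "W (ce_fun ?Q 0) = {z. c (ce_fun ?P z) = c emp}"
      by (subst ce_fun(2)) (rule D, simp)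
    then have "W (ce_fun ?Q 0) = {z. z \<notin> W z}" using * by (auto simp: ceq)
    then show False by blast
  qed
  then show ?thesis by metis
qed


section \<open>The ordinals below the square of omega\<close>

definition omega_sq_rel :: "nat rel" where
  "omega_sq_rel = dir_image lex_nat prod_encode"

text \<open>\<open>oseg k n\<close> is \<open>\<omega> \<cdot> k + n\<close>.\<close>

definition oseg :: "nat \<Rightarrow> nat \<Rightarrow> cord" where
  "oseg k n = abs_cord (Restr omega_sq_rel (underS omega_sq_rel (npair k n)))"

lemma Well_order_omega_sq_rel: "Well_order omega_sq_rel"
  unfolding omega_sq_rel_def by (rule Well_order_omega_sq)

lemma omega_sq_rel_iff:
  "(npair k n, npair k' n') \<in> omega_sq_rel \<longleftrightarrow> k < k' \<or> k = k' \<and> n \<le> n'"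
  unfolding omega_sq_rel_def dir_image_def lex_nat_def by auto

lemma Field_omega_sq_rel: "Field omega_sq_rel = UNIV"
proof -
  have "(z, z) \<in> omega_sq_rel" for z
    using omega_sq_rel_iff[of "nfst z" "nsnd z" "nfst z" "nsnd z"] by simp
  then show ?thesis by (auto simp: Field_def)
qed

lemma Well_order_oseg: "Well_order (Restr omega_sq_rel (underS omega_sq_rel a))"
  by (rule Well_order_Restr[OF Well_order_omega_sq_rel])

lemma oseg_less_omega_sq: "oseg k n < omega_sq"
proof -
  have "Restr omega_sq_rel (underS omega_sq_rel (npair k n)) <o omega_sq_rel"
    by (rule underS_Restr_ordLess[OF Well_order_omega_sq_rel]) (simp add: Field_omega_sq_rel)
  then show ?thesis
    by (simp add: oseg_def omega_sq_def omega_sq_rel_def[symmetric] less_cord.abs_eq ordIso_self_iff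
        Well_order_oseg Well_order_omega_sq_rel)
qed

lemma less_omega_sqE:
  assumes "x < omega_sq" obtains k n where "x = oseg k n"
proof -
  obtain r where r: "Well_order r" "x = abs_cord r" by (rule cord_cases)
  then have "r <o omega_sq_rel"
    using assms by (simp add: omega_sq_def omega_sq_rel_def[symmetric] less_cord.abs_eq ordIso_self_iff
        Well_order_omega_sq_rel)
  then obtain a where "r =o Restr omega_sq_rel (underS omega_sq_rel a)"
    using ordLess_iff_ordIso_Restr[OF Well_order_omega_sq_rel r(1)] by blast
  then have "x = oseg (nfst a) (nsnd a)"
    unfolding oseg_def r(2) by (auto intro!: Quotient3_rel_abs[OF Quotient3_cord])
  then show ?thesis by (rule that)
qed

lemma oseg_strict_mono:
  assumes "k < k' \<or> k = k' \<and> n < n'" shows "oseg k n < oseg k' n'"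
proof -
  have *: "npair a b \<in> underS omega_sq_rel (npair i j) \<longleftrightarrow> a < i \<or> a = i \<and> b < j" for a b i j
    by (auto simp: underS_def omega_sq_rel_iff)
  have sub: "underS omega_sq_rel (npair k n) \<subset> underS omega_sq_rel (npair k' n')"
  proof
    show "underS omega_sq_rel (npair k n) \<subseteq> underS omega_sq_rel (npair k' n')"
    proof
      fix z assume z: "z \<in> underS omega_sq_rel (npair k n)"
      obtain a b where "z = npair a b" using that[of "nfst z" "nsnd z"] by simp
      with z show "z \<in> underS omega_sq_rel (npair k' n')" using assms by (auto simp: *)
    qed
    have "npair k n \<in> underS omega_sq_rel (npair k' n')" "npair k n \<notin> underS omega_sq_rel (npair k n)"
      unfolding * using assms by auto
    then show "underS omega_sq_rel (npair k n) \<noteq> underS omega_sq_rel (npair k' n')" by blast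
  qed
  have "wo_rel omega_sq_rel" by (simp add: wo_rel_def Well_order_omega_sq_rel)
  note ofilter = wo_rel.underS_ofilter[OF this]
  have "Restr omega_sq_rel (underS omega_sq_rel (npair k n)) <o
      Restr omega_sq_rel (underS omega_sq_rel (npair k' n'))"
    unfolding ofilter_subset_ordLess[OF Well_order_omega_sq_rel ofilter ofilter, symmetric] by (rule sub)
  then show ?thesis
    by (simp add: oseg_def less_cord.abs_eq ordIso_self_iff Well_order_oseg)
qed

lemma oseg_less_iff: "oseg k n < oseg k' n' \<longleftrightarrow> k < k' \<or> k = k' \<and> n < n'"
proof
  assume *: "oseg k n < oseg k' n'"
  show "k < k' \<or> k = k' \<and> n < n'"
  proof (rule ccontr)
    assume "\<not> (k < k' \<or> k = k' \<and> n < n')"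
    then have "oseg k' n' < oseg k n \<or> oseg k' n' = oseg k n"
      using oseg_strict_mono[of k' k n' n] by (metis linorder_neqE_nat)
    with * show False by auto
  qed
qed (rule oseg_strict_mono)

lemma oseg_le_iff: "oseg k n \<le> oseg k' n' \<longleftrightarrow> k < k' \<or> k = k' \<and> n \<le> n'"
  using oseg_less_iff[of k' n' k n] by (auto simp: not_less[symmetric])

lemma ord_zero_eq: "ord_zero = oseg 0 0"
proof -
  have le: "ord_zero \<le> oseg 0 0" unfolding ord_zero_def by (rule Least_le) simp
  then obtain k n where "ord_zero = oseg k n"
    using oseg_less_omega_sq[of 0 0] less_omega_sqE by (meson order_le_less_trans)
  with le show ?thesis by (metis oseg_le_iff le_zero_eq not_less_zero)
qed

lemma ord_succ_oseg: "ord_succ (oseg k n) = oseg k (Suc n)"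
proof -
  have le: "ord_succ (oseg k n) \<le> oseg k (Suc n)"
    by (simp add: ord_succ_le_iff oseg_less_iff)
  then obtain k' n' where eq: "ord_succ (oseg k n) = oseg k' n'"
    using oseg_less_omega_sq less_omega_sqE by (meson order_le_less_trans)
  moreover have "oseg k n < oseg k' n'" using less_ord_succ[of "oseg k n"] eq by simp
  ultimately have "k = k'" "n' = Suc n" using le by (auto simp: oseg_less_iff oseg_le_iff)
  with eq show ?thesis by simp
qed

lemma ord_sup_eq_oseg:
  assumes le: "\<And>n. \<alpha> n \<le> oseg (Suc k) 0" and eq: "\<And>n. \<alpha> (n0 + n) = oseg k (n + m)"
  shows "ord_sup \<alpha> = oseg (Suc k) 0"
proof -
  have sup: "ord_sup \<alpha> \<le> oseg (Suc k) 0" using le by (simp add: ord_sup_le_iff)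
  then obtain k' n' where eq': "ord_sup \<alpha> = oseg k' n'"
    using oseg_less_omega_sq less_omega_sqE by (meson order_le_less_trans)
  have "oseg k (Suc n' + m) \<le> oseg k' n'"
    using ord_sup_upper[of \<alpha> "n0 + Suc n'"] eq[of "Suc n'"] eq' by simp
  then have "k < k'" by (auto simp: oseg_le_iff)
  with sup eq' show ?thesis by (auto simp: oseg_le_iff)
qed

lemma ord_sup_eq_omega_sq:
  assumes eq: "\<And>n. \<alpha> n = oseg (g n) (h n)" and g: "\<And>n. n \<le> g n"
  shows "ord_sup \<alpha> = omega_sq"
proof (rule antisym)
  show "ord_sup \<alpha> \<le> omega_sq"
    using oseg_less_omega_sq by (simp add: ord_sup_le_iff eq less_imp_le)
  show "omega_sq \<le> ord_sup \<alpha>"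
  proof (rule ccontr)
    assume "\<not> omega_sq \<le> ord_sup \<alpha>"
    then obtain k n where "ord_sup \<alpha> = oseg k n" using less_omega_sqE by (meson not_le)
    moreover have "\<alpha> (Suc k) \<le> ord_sup \<alpha>" by (rule ord_sup_upper)
    ultimately show False using g[of "Suc k"] by (auto simp: eq oseg_le_iff)
  qed
qed


section \<open>Iterated jumps along limits of finite rank\<close>

lemma equiv_Id: "equiv UNIV Id"
  by (simp add: equiv_def refl_on_def sym_Id trans_Id)

lemma equiv_iter_jump:
  assumes "equiv UNIV E" "KO a" shows "equiv UNIV (iter_jump E a)"
  using assms(2)
proof (induction a rule: KO_KO_less.inducts(1)[where ?P2.0 = "\<lambda>_ _. True"])
  case KO_one
  show ?case unfolding iter_jump_simps(1) by (rule assms(1))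
next
  case (KO_suc b)
  then show ?case by (simp add: iter_jump_simps(2) equiv_jump)
next
  case (KO_lim e f)
  have "iter_jump E (3 * 5 ^ e) = direct_sum (\<lambda>n. iter_jump E (f n))"
    by (rule iter_jump_simps(3)) (use KO_lim in blast)+
  then show ?case using KO_lim by (simp add: equiv_direct_sum)
qed simp_all

abbreviation tower :: "nat \<Rightarrow> nat \<Rightarrow> nat" where
  "tower n \<equiv> (\<lambda>z. 2 ^ z) ^^ n"

lemma KO_tower: "KO z \<Longrightarrow> KO (tower n z)"
  by (induction n) (simp_all add: KO_suc)

lemma KO_less_tower: "KO z \<Longrightarrow> m < n \<Longrightarrow> tower m z <\<^sub>O tower n z"
proof (induction n)
  case (Suc n)
  have "tower n z <\<^sub>O tower (Suc n) z" using KO_less_suc[OF KO_tower[OF Suc.prems(1)]] by simp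
  then show ?case using Suc by (auto simp: less_Suc_eq intro: KO_less_trans)
qed simp

lemma iter_jump_tower: "KO z \<Longrightarrow> iter_jump E (tower n z) = (jump ^^ n) (iter_jump E z)"
  by (induction n) (simp_all add: iter_jump_simps(2) KO_tower)

lemma ord_of_tower: "KO z \<Longrightarrow> ord_of z = oseg k 0 \<Longrightarrow> ord_of (tower n z) = oseg k n"
  by (induction n) (simp_all add: ord_of_simps(2) KO_tower ord_succ_oseg)

lemma KO_less_seq:
  assumes "\<And>n. f n <\<^sub>O f (Suc n)" "m < n" shows "f m <\<^sub>O f n"
  using assms(2) by (induction n) (auto simp: less_Suc_eq intro: KO_less_trans assms(1))

lemma iter_jump_mono:
  assumes E: "equiv UNIV E" and "a <\<^sub>O b" shows "iter_jump E a \<le>\<^sub>c iter_jump E b"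
  using assms(2)
proof (induction a b rule: KO_KO_less.inducts(2)[where ?P1.0 = KO])
  case (KO_less_suc b)
  then show ?case
    using reducible_jump_funpow[OF equiv_iter_jump[OF E], of b 0 1] by (simp add: iter_jump_simps(2))
next
  case (KO_less_lim e f n)
  have "iter_jump E (3 * 5 ^ e) = direct_sum (\<lambda>n. iter_jump E (f n))"
    by (rule iter_jump_simps(3)) (use KO_less_lim in blast)+
  then show ?case using reducible_direct_sum[of "\<lambda>n. iter_jump E (f n)"] by simp
next
  case (KO_less_trans a b c)
  then show ?case by (blast intro: reducible_trans)
qed (auto intro: KO_one[unfolded One_nat_def] KO_KO_less.intros)

text \<open>\<open>lim_ht a k\<close> says that \<open>a\<close> denotes \<open>\<omega> \<cdot> k\<close>. The tail condition on \<open>f\<close> makes the columns of the sum at a limit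
  uniformly computable from the relation at the previous limit.\<close>

inductive lim_ht :: "nat \<Rightarrow> nat \<Rightarrow> bool" where
  lim_ht_0: "lim_ht 1 0"
| lim_ht_Suc: "\<lbrakk>lim_ht a k; \<And>n. phi e n = Some (f n); \<And>n. KO (f n); \<And>n. f n <\<^sub>O f (Suc n);
    \<And>n. f (n0 + n) = tower (n + m) a\<rbrakk> \<Longrightarrow> lim_ht (3 * 5 ^ e) (Suc k)"

lemma KO_lim_ht: "lim_ht a k \<Longrightarrow> KO a"
proof (induction rule: lim_ht.induct)
  case lim_ht_0
  show ?case by (rule KO_one)
next
  case (lim_ht_Suc a k e f n0 m)
  show ?case by (rule KO_lim[of e f]) (use lim_ht_Suc in blast)+
qed

lemma ord_of_lim_ht: "lim_ht a k \<Longrightarrow> ord_of a = oseg k 0"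
proof (induction rule: lim_ht.induct)
  case lim_ht_0
  show ?case unfolding ord_of_simps(1) by (rule ord_zero_eq)
next
  case (lim_ht_Suc a k e f n0 m)
  have "ord_of (3 * 5 ^ e) = ord_sup (\<lambda>n. ord_of (f n))"
    by (rule ord_of_simps(3)) (use lim_ht_Suc in blast)+
  also have "\<dots> = oseg (Suc k) 0"
  proof (rule ord_sup_eq_oseg)
    show eq: "ord_of (f (n0 + n)) = oseg k (n + m)" for n
      using ord_of_tower[OF KO_lim_ht[OF lim_ht_Suc(1)] lim_ht_Suc.IH] lim_ht_Suc(5) by simp
    show "ord_of (f n) \<le> oseg (Suc k) 0" for n
    proof -
      have "f n <\<^sub>O f (n0 + Suc n)" by (rule KO_less_seq) (use lim_ht_Suc in simp_all)
      then have "ord_of (f n) < ord_of (f (n0 + Suc n))" by (rule KO_less_imp_ord_less[THEN conjunct2, THEN conjunct2])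
      also have "\<dots> < oseg (Suc k) 0" unfolding eq by (simp add: oseg_less_iff)
      finally show ?thesis by simp
    qed
  qed
  finally show ?case .
qed

lemma lim_ht_0_iff: "lim_ht a 0 \<longleftrightarrow> a = 1"
  using lim_ht_0 by (auto elim: lim_ht.cases)

lemma lim_ht_SucE:
  assumes "lim_ht b (Suc k)"
  obtains a where "lim_ht a k" "a <\<^sub>O b"
    "direct_sum (\<lambda>n. (jump ^^ n) (iter_jump Id a)) \<le>\<^sub>c iter_jump Id b"
  using assms
proof (cases rule: lim_ht.cases)
  case (lim_ht_Suc a e f n0 m)
  note f = lim_ht_Suc(3-6) and KO = KO_lim_ht[OF lim_ht_Suc(2)]
  let ?F = "iter_jump Id a"
  have F: "equiv UNIV ?F" by (rule equiv_iter_jump[OF equiv_Id KO])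
  have "f n0 <\<^sub>O b" unfolding lim_ht_Suc(1) by (rule KO_less_lim) (use f in blast)+
  moreover have "a = f n0 \<or> a <\<^sub>O f n0"
    using f(4)[of 0] KO_less_tower[OF KO, of 0 m] by (cases m) auto
  ultimately have "a <\<^sub>O b" by (auto intro: KO_less_trans)
  moreover have "direct_sum (\<lambda>n. (jump ^^ n) ?F) \<le>\<^sub>c iter_jump Id b"
  proof -
    have b: "iter_jump Id b = direct_sum (\<lambda>n. iter_jump Id (f n))"
      unfolding lim_ht_Suc(1) by (rule iter_jump_simps(3)) (use f in blast)+
    let ?g = "\<lambda>z. npair (n0 + nfst z) ((sing ^^ m) (nsnd z))"
    have "(x, y) \<in> direct_sum (\<lambda>n. (jump ^^ n) ?F) \<longleftrightarrow> (?g x, ?g y) \<in> iter_jump Id b" for x y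
      unfolding b by (simp add: direct_sum_iff f(4) iter_jump_tower[OF KO] add.commute[of _ m]
          jump_funpow_sing_iff'[OF F])
    moreover have "computable ?g"
      by (intro computable_intros computable_funpow computable_sing)
    ultimately show ?thesis unfolding reducible_def by blast
  qed
  ultimately show ?thesis using that lim_ht_Suc(2) by blast
qed

lemma lim_ht_below:
  "lim_ht b k \<Longrightarrow> j \<le> k \<Longrightarrow> \<exists>a. lim_ht a j \<and> (a = b \<or> a <\<^sub>O b)"
proof (induction k arbitrary: b)
  case (Suc k)
  show ?case
  proof (cases "j = Suc k")
    case False
    obtain a where "lim_ht a k" "a <\<^sub>O b" using Suc.prems(1) by (rule lim_ht_SucE)
    then show ?thesis using Suc.IH[of a] Suc.prems False by (auto intro: KO_less_trans)
  qed (use Suc in blast)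
qed auto

lemma coded_pairs_reducible:
  assumes "coded F (pairs R')" "R \<le>\<^sub>c R'" shows "coded F (pairs R)"
proof -
  obtain f where f: "computable f" "\<And>x y. (x, y) \<in> R \<longleftrightarrow> (f x, f y) \<in> R'"
    using assms(2) unfolding reducible_def by blast
  have "coded F {n. npair (f (nfst n)) (f (nsnd n)) \<in> pairs R'}"
    by (intro coded_preimage assms(1) computable_intros f(1)[THEN computable_comp])
  moreover have "{n. npair (f (nfst n)) (f (nsnd n)) \<in> pairs R'} = pairs R"
    unfolding pairs_def f(2) by simp
  ultimately show ?thesis by simp
qed

lemma computable_finite_change:
  assumes "computable f" "\<And>n. n0 \<le> n \<Longrightarrow> g n = f n" shows "computable g"
  using assms
proof (induction n0 arbitrary: f)
  case 0
  then show ?case by (metis ext le0)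
next
  case (Suc n0)
  show ?case
    by (rule Suc.IH[OF computable_fun_upd[OF Suc.prems(1), of n0 "g n0"]])
      (use Suc.prems(2) in \<open>auto simp: Suc_le_eq order_le_less[of n0]\<close>)
qed

lemma coded_iter_jump:
  "lim_ht b k \<Longrightarrow> lim_ht a (2 * k) \<Longrightarrow> coded (iter_jump Id a) (pairs (iter_jump Id b))"
proof (induction arbitrary: a rule: lim_ht.induct)
  case lim_ht_0
  then have "a = 1" by (simp add: lim_ht_0_iff)
  have "coded Id {n. nfst n = nsnd n}"
    by (rule coded_decidable[of _ 0 1]) (auto simp: equiv_Id intro!: computable_intros)
  moreover have "{n. nfst n = nsnd n} = pairs Id" by (simp add: pairs_def del: prod.collapse)
  ultimately show ?case unfolding \<open>a = 1\<close> iter_jump_simps(1) by simp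
next
  case (lim_ht_Suc b k e f n0 m)
  note f = lim_ht_Suc(2-5)
  obtain a' where a': "lim_ht a' (Suc (2 * k))" and
    red': "direct_sum (\<lambda>n. (jump ^^ n) (iter_jump Id a')) \<le>\<^sub>c iter_jump Id a"
    using lim_ht_SucE[of a "Suc (2 * k)"] lim_ht_Suc.prems by (metis mult_Suc_right numeral_2_eq_2 add_Suc add_0)
  obtain a'' where a'': "lim_ht a'' (2 * k)" and
    red'': "direct_sum (\<lambda>n. (jump ^^ n) (iter_jump Id a'')) \<le>\<^sub>c iter_jump Id a'"
    using lim_ht_SucE[OF a'] by blast
  define F F' R where "F = iter_jump Id a''" and "F' = iter_jump Id a'" and "R n = iter_jump Id (f n)" for n
  have F: "equiv UNIV F" and F': "equiv UNIV F'" and R: "equiv UNIV (R n)" for n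
    unfolding F_def F'_def R_def
    by (auto intro!: equiv_iter_jump equiv_Id KO_lim_ht[OF a''] KO_lim_ht[OF a'] f(2))
  have b: "equiv UNIV (iter_jump Id b)" "KO b"
    using KO_lim_ht[OF lim_ht_Suc(1)] by (auto intro: equiv_iter_jump equiv_Id)
  have Rn0: "R (n0 + n) = (jump ^^ (n + m)) (iter_jump Id b)" for n
    unfolding R_def f(4) by (rule iter_jump_tower[OF b(2)])
  have coded_b: "coded F (pairs (iter_jump Id b))"
    unfolding F_def by (rule lim_ht_Suc.IH[OF a''])
  let ?F = "\<lambda>n. (jump ^^ (6 * (n + m))) F"
  have "coded ((jump ^^ (6 * n0)) F) (pairs (iter_jump Id b))"
    by (rule coded_mono[OF coded_b]) (use reducible_jump_funpow[OF F, of 0] in simp)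
  then obtain c where c: "codes ((jump ^^ (6 * n0)) F) (pairs (iter_jump Id b)) c"
    unfolding coded_def by blast
  let ?C = "\<lambda>n. (jump_code ^^ (n - n0 + m)) c"
  have C: "codes (?F n) (pairs (R n)) (?C n)" if "n0 \<le> n" for n
  proof -
    have "?F n = (jump ^^ (6 * (n - n0 + m))) ((jump ^^ (6 * n0)) F)"
      using that by (simp add: funpow_add[THEN fun_cong, unfolded comp_apply, symmetric] algebra_simps)
    moreover have "R n = (jump ^^ (n - n0 + m)) (iter_jump Id b)" using Rn0[of "n - n0"] that by simp
    ultimately show ?thesis
      by (simp only: codes_jump_code_funpow[OF equiv_jump_funpow[OF F] b(1) c])
  qed
  have "\<exists>c. codes (?F n) (pairs (R n)) c" if "n < n0" for n
  proof -
    obtain c where "codes F (pairs (iter_jump Id b)) c" using coded_b unfolding coded_def by blast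
    then have "coded ((jump ^^ (6 * m)) F) (pairs (R n0))"
      using codes_jump_code_funpow[OF F b(1)] Rn0[of 0] unfolding coded_def by auto
    then have "coded ((jump ^^ (6 * m)) F) (pairs (R n))"
      using iter_jump_mono[OF equiv_Id KO_less_seq[of f, OF f(3) that]] unfolding R_def
      by (rule coded_pairs_reducible)
    then have "coded (?F n) (pairs (R n))"
      by (rule coded_mono) (rule reducible_jump_funpow[OF F], simp)
    then show ?thesis unfolding coded_def .
  qed
  then obtain D where D: "\<And>n. n < n0 \<Longrightarrow> codes (?F n) (pairs (R n)) (D n)" by metis
  define C where "C n = (if n < n0 then D n else ?C n)" for n
  have "computable ?C"
    by (intro computable_funpow computable_jump_code computable_intros)
  then have compC: "computable C" by (rule computable_finite_change[of _ n0]) (simp add: C_def)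
  obtain r where r: "computable r" "\<And>x y. (x, y) \<in> direct_sum (\<lambda>n. (jump ^^ n) F) \<longleftrightarrow> (r x, r y) \<in> F'"
    using red'' unfolding reducible_def F_def F'_def by blast
  let ?emb = "\<lambda>z. r (npair (6 * (nfst z + m)) (nsnd z))"
  have "coded (jump (jump F')) {z. nsnd z \<in> pairs (R (nfst z))}"
  proof (rule coded_direct_sum[OF F' _ _ _ compC])
    show "equiv UNIV (?F i)" for i by (rule equiv_jump_funpow[OF F])
    show "computable ?emb" by (intro r(1)[THEN computable_comp] computable_intros)
    show "(?emb (npair i x), ?emb (npair j y)) \<in> F' \<longleftrightarrow> i = j \<and> (x, y) \<in> ?F i" for i j x y
      by (simp add: r(2)[symmetric] direct_sum_iff)
    show "codes (?F i) (pairs (R i)) (C i)" for i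
      using C D by (simp add: C_def)
  qed
  from coded_preimage[OF this, of "\<lambda>z. npair (nfst (nfst z)) (npair (nsnd (nfst z)) (nsnd (nsnd z)))"]
  have "coded (jump (jump F')) {z. (nsnd (nfst z), nsnd (nsnd z)) \<in> R (nfst (nfst z))}"
    by (simp add: computable_intros pairs_def)
  from coded_Int_decidable[OF equiv_jump this, of "\<lambda>z. nfst (nfst z) = nfst (nsnd z)"]
  have "coded (jump (jump F')) (pairs (direct_sum R))"
    by (simp add: computable_intros pairs_def direct_sum_iff del: prod.collapse)
  moreover have "iter_jump Id (3 * 5 ^ e) = direct_sum R"
    unfolding R_def by (rule iter_jump_simps(3)) (use f in blast)+
  moreover have "jump (jump F') \<le>\<^sub>c iter_jump Id a"
    using reducible_trans[OF reducible_direct_sum[of "\<lambda>n. (jump ^^ n) F'" 2]] red'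
    unfolding F'_def by (simp add: numeral_2_eq_2)
  ultimately show ?case using coded_mono by simp
qed

lemma not_reducible_lim_ht:
  assumes a: "lim_ht a j" and b: "lim_ht b k" and jk: "2 * k < j"
  shows "\<not> jump (iter_jump Id a) \<le>\<^sub>c jump (iter_jump Id b)"
proof
  assume red: "jump (iter_jump Id a) \<le>\<^sub>c jump (iter_jump Id b)"
  obtain a' where a': "lim_ht a' (Suc (2 * k))" "a' = a \<or> a' <\<^sub>O a"
    using lim_ht_below[OF a] jk by (meson Suc_leI)
  obtain a'' where a'': "lim_ht a'' (2 * k)" and
    red'': "direct_sum (\<lambda>n. (jump ^^ n) (iter_jump Id a'')) \<le>\<^sub>c iter_jump Id a'"
    using lim_ht_SucE[OF a'(1)] by blast
  let ?F = "iter_jump Id a''"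
  have F: "equiv UNIV ?F" by (rule equiv_iter_jump[OF equiv_Id KO_lim_ht[OF a'']])
  have A: "equiv UNIV (iter_jump Id a)" by (rule equiv_iter_jump[OF equiv_Id KO_lim_ht[OF a]])
  have B: "equiv UNIV (iter_jump Id b)" by (rule equiv_iter_jump[OF equiv_Id KO_lim_ht[OF b]])
  have "coded ((jump ^^ 6) ?F) (pairs (jump (iter_jump Id b)))"
    using coded_iter_jump[OF b a''] codes_jump_code[OF F B] unfolding coded_def by blast
  moreover have "(jump ^^ 3) ((jump ^^ 6) ?F) \<le>\<^sub>c jump (iter_jump Id b)"
  proof -
    have "(jump ^^ 3) ((jump ^^ 6) ?F) = (jump ^^ 9) ?F" by (simp add: numeral_eq_Suc)
    then have "(jump ^^ 3) ((jump ^^ 6) ?F) \<le>\<^sub>c iter_jump Id a'"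
      using reducible_trans[OF reducible_direct_sum[of "\<lambda>n. (jump ^^ n) ?F" 9] red''] by simp
    moreover have "iter_jump Id a' \<le>\<^sub>c iter_jump Id a"
      using a'(2) iter_jump_mono[OF equiv_Id] reducible_refl by blast
    moreover have "iter_jump Id a \<le>\<^sub>c jump (iter_jump Id a)"
      using reducible_jump_funpow[OF A, of 0 1] by simp
    ultimately show ?thesis using red by (blast intro: reducible_trans)
  qed
  ultimately show False
    using not_coded_of_reducible[OF equiv_jump equiv_jump_funpow[OF F]] by blast
qed

text \<open>A reduction between the direct sums maps the columns by a computable function, since by Rice's theorem
  it cannot split a column that is a jump.\<close>

lemma reducible_direct_sum_jump:
  assumes "direct_sum (\<lambda>i. jump (E i)) \<le>\<^sub>c direct_sum R"
  shows "\<exists>c. computable c \<and> (\<forall>i. jump (E i) \<le>\<^sub>c R (c i))"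
proof -
  obtain f where f: "computable f"
    "\<And>x y. (x, y) \<in> direct_sum (\<lambda>i. jump (E i)) \<longleftrightarrow> (f x, f y) \<in> direct_sum R"
    using assms unfolding reducible_def by blast
  have comp: "computable (\<lambda>x. f (npair i x))" for i
    by (intro f(1)[THEN computable_comp] computable_intros)
  let ?c = "\<lambda>i. nfst (f (npair i 0))"
  have "computable ?c" by (intro f(1)[THEN computable_comp] computable_intros)
  moreover have "jump (E i) \<le>\<^sub>c R (?c i)" for i
  proof -
    have W: "nfst (f (npair i x)) = nfst (f (npair i y))" if "W x = W y" for x y
      using f(2)[of "npair i x" "npair i y"] jump_W_eq[OF that] by (simp add: direct_sum_iff)
    have const: "nfst (f (npair i x)) = ?c i" for x
      by (rule Rice_constant[of "\<lambda>x. nfst (f (npair i x))", OF computable_nfst[OF comp] W])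
    have "(x, y) \<in> jump (E i) \<longleftrightarrow> (nsnd (f (npair i x)), nsnd (f (npair i y))) \<in> R (?c i)" for x y
      using f(2)[of "npair i x" "npair i y"] const[of x] const[of y] by (simp add: direct_sum_iff)
    moreover have "computable (\<lambda>x. nsnd (f (npair i x)))" using comp by (rule computable_nsnd)
    ultimately show ?thesis unfolding reducible_def by blast
  qed
  ultimately show ?thesis by blast
qed

lemma not_reducible_direct_sum_lim_ht:
  assumes a: "\<And>i. lim_ht (a i) (g i)" and b: "\<And>i. lim_ht (b i) (h i)"
    and gh: "\<And>c. computable c \<Longrightarrow> \<exists>i. 2 * h (c i) < g i"
  shows "\<not> direct_sum (\<lambda>i. jump (iter_jump Id (a i))) \<le>\<^sub>c direct_sum (\<lambda>i. jump (iter_jump Id (b i)))"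
proof
  assume "direct_sum (\<lambda>i. jump (iter_jump Id (a i))) \<le>\<^sub>c direct_sum (\<lambda>i. jump (iter_jump Id (b i)))"
  from reducible_direct_sum_jump[OF this] obtain c where
    "computable c" "\<And>i. jump (iter_jump Id (a i)) \<le>\<^sub>c jump (iter_jump Id (b (c i)))"
    by blast
  then show False using gh not_reducible_lim_ht[OF a b] by blast
qed


section \<open>The priority construction\<close>

text \<open>
  Stage \<open>s\<close> treats the requirement \<open>k = nfst s\<close>, that the program \<open>k div 2\<close> does not dominate the heights on side
  \<open>k mod 2\<close> by those on the other side; smaller \<open>k\<close> have priority. Acting raises the heights beyond the witness of \<open>k\<close> by
  one. The witness exceeds every stage at which a requirement of higher priority has acted, hence every
  value \<open>j < s\<close> that such a requirement has to protect. \<open>p\<close> is the set of stages that acted.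
\<close>

primrec last_act :: "(nat \<Rightarrow> bool) \<Rightarrow> nat \<Rightarrow> nat \<Rightarrow> nat" where
  "last_act p k 0 = 0"
| "last_act p k (Suc t) = (if p t \<and> nfst t < k then Suc t else last_act p k t)"

definition witness :: "(nat \<Rightarrow> bool) \<Rightarrow> nat \<Rightarrow> nat" where
  "witness p s = nfst s + last_act p (nfst s) s"

abbreviation side :: "nat \<Rightarrow> nat" where
  "side s \<equiv> nfst s mod 2"

primrec height :: "(nat \<Rightarrow> bool) \<Rightarrow> nat \<Rightarrow> nat \<Rightarrow> nat \<Rightarrow> nat" where
  "height p \<sigma> i 0 = i"
| "height p \<sigma> i (Suc t) =
    height p \<sigma> i t + (if p t \<and> side t = \<sigma> \<and> witness p t < i then 1 else 0)"

definition attention :: "(nat \<Rightarrow> bool) \<Rightarrow> nat \<Rightarrow> bool" where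
  "attention p s \<longleftrightarrow> (\<exists>j<s. steps (nfst s div 2) (Suc (witness p s)) j s \<and>
    height p (side s) (Suc (witness p s)) s \<le> 2 * height p (1 - side s) j s)"

primrec history :: "nat \<Rightarrow> nat" where
  "history 0 = 0"
| "history (Suc s) = (if attention (bit (history s)) s then set_bit s (history s) else history s)"

definition act :: "nat \<Rightarrow> bool" where
  "act s = attention (bit (history s)) s"

lemma bit_history: "bit (history s) t \<longleftrightarrow> t < s \<and> act t"
  by (induction s) (auto simp: bit_set_bit_nat less_Suc_eq act_def)

lemma last_act_cong: "(\<And>t. t < s \<Longrightarrow> p t = q t) \<Longrightarrow> last_act p k s = last_act q k s"
  by (induction s) auto

lemma witness_cong: "(\<And>t. t < s \<Longrightarrow> p t = q t) \<Longrightarrow> witness p s = witness q s"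
  unfolding witness_def by (rule arg_cong[OF last_act_cong])

lemma height_cong: "(\<And>t. t < s \<Longrightarrow> p t = q t) \<Longrightarrow> height p \<sigma> i s = height q \<sigma> i s"
proof (induction s)
  case (Suc s)
  then have "witness p s = witness q s" by (intro witness_cong) simp
  with Suc show ?case by simp
qed simp

lemma witness_history: "witness (bit (history s)) s = witness act s"
  by (rule witness_cong) (simp add: bit_history)

lemma act_iff: "act s \<longleftrightarrow> attention act s"
proof -
  have "height (bit (history s)) \<sigma> i s = height act \<sigma> i s" for \<sigma> i
    by (rule height_cong) (simp add: bit_history)
  then show ?thesis by (simp add: act_def attention_def witness_history)
qed

lemma computable_last_act:
  assumes "computable A" "computable k" "computable s"
  shows "computable (\<lambda>x. last_act (bit (A x)) (k x) (s x))"
proof -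
  have "last_act p k n = rec_nat 0 (\<lambda>t r. if p t \<and> nfst t < k then Suc t else r) n" for p k n
    by (induction n) simp_all
  then show ?thesis
    by (simp only:) (intro computable_intros assms assms(1,2)[THEN computable_comp])
qed

lemma computable_witness:
  assumes "computable A" "computable s" shows "computable (\<lambda>x. witness (bit (A x)) (s x))"
  unfolding witness_def by (intro computable_intros computable_last_act assms)

lemma computable_height:
  assumes "computable A" "computable \<sigma>" "computable i" "computable s"
  shows "computable (\<lambda>x. height (bit (A x)) (\<sigma> x) (i x) (s x))"
proof -
  have "height p \<sigma> i n = rec_nat i (\<lambda>t r. r + (if p t \<and> side t = \<sigma> \<and> witness p t < i then 1 else 0)) n"
    for p \<sigma> i n by (induction n) simp_all
  then show ?thesis
    by (simp only:) (intro computable_intros computable_witness assms assms(1-3)[THEN computable_comp])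
qed

lemma decidable_attention:
  assumes "computable A" "computable s"
  shows "decidable (\<lambda>x. attention (bit (A x)) (s x))"
  unfolding attention_def
  by (intro computable_intros decidable_steps computable_witness computable_height assms
      assms[THEN computable_comp])

lemma computable_history: "computable history"
proof -
  have "history = rec_nat 0 (\<lambda>s A. if attention (bit A) s then set_bit s A else A)"
  proof
    show "history n = rec_nat 0 (\<lambda>s A. if attention (bit A) s then set_bit s A else A) n" for n
      by (induction n) simp_all
  qed
  moreover have "computable (\<lambda>n. rec_nat 0 (\<lambda>s A. if attention (bit A) s then set_bit s A else A) n)"
    by (intro computable_intros decidable_attention)
  ultimately show ?thesis by simp
qed

definition event :: "nat \<Rightarrow> nat \<Rightarrow> nat \<Rightarrow> bool" where
  "event \<sigma> i s \<longleftrightarrow> act s \<and> side s = \<sigma> \<and> witness act s = i"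

lemma decidable_event:
  assumes "computable i" "computable s" shows "decidable (\<lambda>x. event \<sigma> (i x) (s x))"
  unfolding event_def witness_history[symmetric] act_def
  by (intro computable_intros decidable_attention computable_witness assms
      assms[THEN computable_comp] computable_history[THEN computable_comp])

lemma last_act_ge: "act t \<Longrightarrow> nfst t < k \<Longrightarrow> t < s \<Longrightarrow> t < last_act act k s"
proof (induction s)
  case (Suc s)
  then show ?case by (cases "t = s") auto
qed simp

lemma last_act_const:
  assumes "\<And>t. s0 \<le> t \<Longrightarrow> act t \<Longrightarrow> \<not> nfst t < k" "s0 \<le> s"
  shows "last_act act k s = last_act act k s0"
  using assms(2) by (induction s rule: dec_induct) (use assms(1) in auto)

lemma height_eq_card: "height p \<sigma> i s = i + card {t. t < s \<and> p t \<and> side t = \<sigma> \<and> witness p t < i}"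
proof (induction s)
  case (Suc s)
  have "{t. t < Suc s \<and> p t \<and> side t = \<sigma> \<and> witness p t < i} =
    (if p s \<and> side s = \<sigma> \<and> witness p s < i then {s} else {}) \<union>
      {t. t < s \<and> p t \<and> side t = \<sigma> \<and> witness p t < i}" by (auto simp: less_Suc_eq)
  then show ?case using Suc by simp
qed simp

lemma infinite_nat_unbounded: "infinite S \<Longrightarrow> \<exists>x\<in>S. (m :: nat) \<le> x"
  unfolding finite_nat_set_iff_bounded by (meson not_le)

lemma finite_acts: "finite {s. act s \<and> nfst s = k}"
proof (induction k rule: less_induct)
  case (less k)
  show ?case
  proof (rule ccontr)
    assume inf: "infinite {s. act s \<and> nfst s = k}"
    have "finite (\<Union>k'\<in>{..<k}. {s. act s \<and> nfst s = k'})" using less by simp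
    then obtain s0 where "\<forall>s\<in>(\<Union>k'\<in>{..<k}. {s. act s \<and> nfst s = k'}). s < s0"
      using finite_nat_set_iff_bounded by blast
    then have s0: "\<not> nfst t < k" if "s0 \<le> t" "act t" for t using that by force
    define w where "w = k + last_act act k s0"
    have w: "witness act s = w" if "s0 \<le> s" "nfst s = k" for s
      using last_act_const[OF s0 that(1)] that(2) by (simp add: witness_def w_def)
    obtain s1 where s1: "s0 \<le> s1" "act s1" "nfst s1 = k"
      using infinite_nat_unbounded[OF inf, of s0] by auto
    let ?\<sigma> = "k mod 2"
    obtain j where j: "j < s1" "steps (k div 2) (Suc w) j s1"
      using s1 w[OF s1(1,3)] by (auto simp: act_iff attention_def)
    have same: "height act (1 - ?\<sigma>) j s = height act (1 - ?\<sigma>) j s1" if "s1 \<le> s" for s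
      using that
    proof (induction s rule: dec_induct)
      case (step s)
      have "\<not> (act s \<and> side s = 1 - ?\<sigma> \<and> witness act s < j)"
      proof
        assume s: "act s \<and> side s = 1 - ?\<sigma> \<and> witness act s < j"
        have "nfst s \<noteq> k"
        proof
          assume "nfst s = k"
          then have "k mod 2 = 1 - k mod 2" using s by metis
          then show False by presburger
        qed
        moreover have "\<not> nfst s < k" using s0 s s1(1) step by simp
        ultimately have "k < nfst s" by simp
        moreover have "s1 < s"
          using step(1) s1(3) \<open>nfst s \<noteq> k\<close> by (cases "s1 = s") auto
        ultimately have "s1 < last_act act (nfst s) s" using last_act_ge[of s1 "nfst s" s] s1 by simp
        then show False using s j(1) by (simp add: witness_def)
      qed
      then show ?case using step by simp
    qed simp
    define h where "h = height act (1 - ?\<sigma>) j s1"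
    have bound: "height act ?\<sigma> (Suc w) s \<le> 2 * h" if s: "s1 \<le> s" "act s" "nfst s = k" for s
    proof -
      have w': "witness act s = w" using w s(1,3) s1(1) by simp
      have "attention act s" using s(2) by (simp add: act_iff)
      then obtain j' where j': "steps (k div 2) (Suc w) j' s"
        "height act ?\<sigma> (Suc w) s \<le> 2 * height act (1 - ?\<sigma>) j' s"
        unfolding attention_def w' s(3) by blast
      have "j' = j" using steps_sound[OF j'(1)] steps_sound[OF j(2)] by simp
      then show ?thesis using j'(2) same[OF s(1)] by (simp add: h_def)
    qed
    let ?A = "{s. act s \<and> nfst s = k \<and> s1 \<le> s}"
    have "{s. act s \<and> nfst s = k} \<subseteq> {..<s1} \<union> ?A" by auto
    from infinite_super[OF this inf] have "infinite ?A" by (simp only: finite_Un finite_lessThan simp_thms)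
    from infinite_arbitrarily_large[OF this, of "Suc (2 * h)"]
    obtain B where B: "B \<subseteq> ?A" "finite B" "card B = Suc (2 * h)" by (elim exE conjE)
    obtain s where s: "s \<in> ?A" "\<forall>t\<in>B. t < s"
    proof -
      obtain m where "\<forall>t\<in>B. t < m" using B(2) finite_nat_set_iff_bounded by blast
      moreover obtain s where "m \<le> s" "s \<in> ?A"
        using infinite_nat_unbounded[OF \<open>infinite ?A\<close>] by blast
      ultimately have "s \<in> ?A" "\<forall>t\<in>B. t < s" by (blast, meson less_le_trans)
      then show ?thesis by (rule that)
    qed
    have "B \<subseteq> {t. t < s \<and> act t \<and> side t = ?\<sigma> \<and> witness act t < Suc w}"
    proof
      fix t assume "t \<in> B"
      then have t: "act t" "nfst t = k" "s1 \<le> t" "t < s" using B(1) s(2) by blast+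
      then have "witness act t = w" using w[of t] s1(1) by simp
      with t show "t \<in> {t. t < s \<and> act t \<and> side t = ?\<sigma> \<and> witness act t < Suc w}" by simp
    qed
    then have "card B \<le> height act ?\<sigma> (Suc w) s"
      unfolding height_eq_card by (intro trans_le_add2 card_mono) auto
    then show False using bound[of s] s(1) B(3) by simp
  qed
qed

lemma finite_events: "finite {s. act s \<and> witness act s \<le> i}"
proof (rule finite_subset)
  show "{s. act s \<and> witness act s \<le> i} \<subseteq> (\<Union>k\<in>{..i}. {s. act s \<and> nfst s = k})"
    by (auto simp: witness_def)
qed (simp add: finite_acts)

definition final_height :: "nat \<Rightarrow> nat \<Rightarrow> nat" where
  "final_height \<sigma> i = i + card {s. act s \<and> side s = \<sigma> \<and> witness act s < i}"

lemma finite_act_set: "finite {s. act s \<and> side s = \<sigma> \<and> witness act s < i}"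
  by (rule finite_subset[OF _ finite_events[of i]]) auto

lemma height_le_final_height: "height act \<sigma> i s \<le> final_height \<sigma> i"
  unfolding height_eq_card final_height_def
  by (intro add_left_mono card_mono finite_act_set) auto

lemma height_eq_final_height: "\<exists>s0. \<forall>s\<ge>s0. height act \<sigma> i s = final_height \<sigma> i"
proof -
  obtain s0 where "\<forall>s\<in>{s. act s \<and> side s = \<sigma> \<and> witness act s < i}. s < s0"
    using finite_act_set finite_nat_set_iff_bounded by blast
  then have "{t. t < s \<and> act t \<and> side t = \<sigma> \<and> witness act t < i} =
      {s. act s \<and> side s = \<sigma> \<and> witness act s < i}" if "s0 \<le> s" for s
    using that by force
  then show ?thesis unfolding height_eq_card final_height_def by (intro exI[of _ s0]) simp
qed

lemma final_height_not_dominated: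
  assumes c: "computable c" and \<sigma>: "\<sigma> < 2"
  shows "\<exists>i. 2 * final_height (1 - \<sigma>) (c i) < final_height \<sigma> i"
proof (rule ccontr)
  assume "\<not> (\<exists>i. 2 * final_height (1 - \<sigma>) (c i) < final_height \<sigma> i)"
  then have le: "final_height \<sigma> i \<le> 2 * final_height (1 - \<sigma>) (c i)" for i by (simp add: not_less)
  obtain e where e: "\<And>x. phi e x = Some (c x)" using c unfolding computable_def by blast
  define k where "k = 2 * e + \<sigma>"
  have k: "k div 2 = e" "k mod 2 = \<sigma>" using \<sigma> by (simp_all add: k_def)
  have "finite (\<Union>k'\<in>{..k}. {s. act s \<and> nfst s = k'})" using finite_acts by simp
  then obtain s0 where "\<forall>s\<in>(\<Union>k'\<in>{..k}. {s. act s \<and> nfst s = k'}). s < s0"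
    using finite_nat_set_iff_bounded by blast
  then have s0: "\<not> nfst t \<le> k" if "s0 \<le> t" "act t" for t using that by force
  define w where "w = k + last_act act k s0"
  have w: "witness act s = w" if "s0 \<le> s" "nfst s = k" for s
  proof -
    have "last_act act k s = last_act act k s0"
    proof (rule last_act_const[OF _ that(1)])
      show "\<not> nfst t < k" if "s0 \<le> t" "act t" for t using s0[OF that] by simp
    qed
    then show ?thesis by (simp add: witness_def w_def that(2))
  qed
  obtain s1 where s1: "steps e (Suc w) (c (Suc w)) s1" using steps_complete[OF e] by blast
  obtain s2 where s2: "\<forall>s\<ge>s2. height act (1 - \<sigma>) (c (Suc w)) s = final_height (1 - \<sigma>) (c (Suc w))"
    using height_eq_final_height by blast
  define s where "s = npair k (Max {s0, s1, s2, Suc (c (Suc w))})"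
  have "Max {s0, s1, s2, Suc (c (Suc w))} \<le> s" unfolding s_def by (rule le_prod_encode_2)
  then have s: "s0 \<le> s" "s1 \<le> s" "s2 \<le> s" "c (Suc w) < s" by simp_all
  have "nfst s = k" by (simp add: s_def)
  have "height act \<sigma> (Suc w) s \<le> 2 * height act (1 - \<sigma>) (c (Suc w)) s"
    using height_le_final_height[of \<sigma> "Suc w" s] le[of "Suc w"] s2 s(3) by simp
  then have "attention act s"
    unfolding attention_def w[OF s(1) \<open>nfst s = k\<close>] \<open>nfst s = k\<close> k
    using s(4) steps_mono[OF s(2) s1] by blast
  then have "act s" by (simp add: act_iff)
  then show False using s0[OF s(1)] \<open>nfst s = k\<close> by simp
qed



section \<open>The two notations\<close>

definition omega_after :: "nat \<Rightarrow> nat" where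
  "omega_after z = 3 * 5 ^ smn_fun (\<lambda>z n. tower n z) z"

lemma computable_tower: "computable n \<Longrightarrow> computable z \<Longrightarrow> computable (\<lambda>x. tower (n x) (z x))"
  by (intro computable_funpow computable_intros)

lemma computable_omega_after: "computable f \<Longrightarrow> computable (\<lambda>x. omega_after (f x))"
  unfolding omega_after_def
  by (intro computable_intros smn_fun(1)[THEN computable_comp] computable_tower)

lemma phi_omega_after: "phi (smn_fun (\<lambda>z n. tower n z) z) n = Some (tower n z)"
  by (rule smn_fun(2)) (intro computable_intros computable_tower)

lemma KO_less_tower_Suc: "KO z \<Longrightarrow> tower n z <\<^sub>O tower (Suc n) z"
  by (rule KO_less_tower) simp_all

lemma KO_less_omega_after: "KO z \<Longrightarrow> tower n z <\<^sub>O omega_after z"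
  unfolding omega_after_def
  by (rule KO_less_lim[OF phi_omega_after KO_tower KO_less_tower_Suc])

lemma lim_ht_omega_after:
  assumes "lim_ht a k" shows "lim_ht (omega_after (tower m a)) (Suc k)"
  unfolding omega_after_def
proof (rule lim_ht_Suc[OF assms phi_omega_after, where m = m and ?n0.0 = 0])
  have KO: "KO (tower m a)" by (intro KO_tower KO_lim_ht[OF assms])
  show "KO (tower n (tower m a))" for n using KO by (rule KO_tower)
  show "tower n (tower m a) <\<^sub>O tower (Suc n) (tower m a)" for n using KO by (rule KO_less_tower_Suc)
  show "tower (0 + n) (tower m a) = tower (n + m) a" for n by (simp add: funpow_add)
qed

primrec climb :: "(nat \<Rightarrow> bool) \<Rightarrow> nat \<Rightarrow> nat \<Rightarrow> nat" where
  "climb ev a 0 = a"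
| "climb ev a (Suc n) = (if ev n then omega_after (climb ev a n) else 2 ^ climb ev a n)"

lemma climb_height:
  assumes "lim_ht a k"
  shows "\<exists>b m. climb ev a n = tower m b \<and> lim_ht b (k + card {t. t < n \<and> ev t})"
proof (induction n)
  case 0
  show ?case using assms by (intro exI[of _ a] exI[of _ 0]) simp
next
  case (Suc n)
  then obtain b m where b: "climb ev a n = tower m b" "lim_ht b (k + card {t. t < n \<and> ev t})" by blast
  have eq: "{t. t < Suc n \<and> ev t} = (if ev n then {n} else {}) \<union> {t. t < n \<and> ev t}"
    by (auto simp: less_Suc_eq)
  show ?case
  proof (cases "ev n")
    case True
    have "lim_ht (omega_after (tower m b)) (Suc (k + card {t. t < n \<and> ev t}))"
      by (rule lim_ht_omega_after[OF b(2)])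
    then show ?thesis unfolding eq using True b(1)
      by (intro exI[of _ "omega_after (tower m b)"] exI[of _ 0]) simp
  next
    case False
    then show ?thesis unfolding eq using b by (intro exI[of _ b] exI[of _ "Suc m"]) simp
  qed
qed

lemma climb:
  assumes a: "lim_ht a k" and fin: "finite {t. ev t}" and e: "\<And>n. phi e n = Some (climb ev a n)"
  shows "lim_ht (3 * 5 ^ e) (Suc (k + card {t. ev t}))" "2 ^ a <\<^sub>O 3 * 5 ^ e"
proof -
  have KO: "KO (climb ev a n)" for n
    using climb_height[OF a, of ev n] KO_tower KO_lim_ht by auto
  have less: "climb ev a n <\<^sub>O climb ev a (Suc n)" for n
    using KO_less_suc[OF KO, of n] KO_less_omega_after[OF KO, of 0 n] by simp
  obtain n0 where n0: "\<And>t. ev t \<Longrightarrow> t < n0" using fin finite_nat_set_iff_bounded by auto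
  then have "{t. t < n0 \<and> ev t} = {t. ev t}" by auto
  then obtain b m where b: "climb ev a n0 = tower m b" "lim_ht b (k + card {t. ev t})"
    using climb_height[OF a, of ev n0] by auto
  have "climb ev a (n0 + n) = tower (n + m) b" for n
  proof (induction n)
    case (Suc n)
    have "\<not> ev (n0 + n)" using n0[of "n0 + n"] by auto
    then show ?case using Suc by simp
  qed (use b in simp)
  then show "lim_ht (3 * 5 ^ e) (Suc (k + card {t. ev t}))"
    by (rule lim_ht_Suc[OF b(2) e KO less])
  have "climb ev a 1 <\<^sub>O 3 * 5 ^ e" by (rule KO_less_lim[OF e KO less])
  moreover have "2 ^ a = climb ev a 1 \<or> 2 ^ a <\<^sub>O climb ev a 1"
    using KO_less_omega_after[OF KO_lim_ht[OF a], of 1] by simp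
  ultimately show "2 ^ a <\<^sub>O 3 * 5 ^ e" by (auto intro: KO_less_trans)
qed

definition climb_index :: "nat \<Rightarrow> nat \<Rightarrow> nat \<Rightarrow> nat" where
  "climb_index \<sigma> i a = smn_fun (\<lambda>z n. climb (event \<sigma> (nfst z)) (nsnd z) n) (npair i a)"

lemma climb_index:
  shows "phi (climb_index \<sigma> i a) n = Some (climb (event \<sigma> i) a n)"
    and "computable f \<Longrightarrow> computable g \<Longrightarrow> computable (\<lambda>x. climb_index \<sigma> (f x) (g x))"
proof -
  have "climb ev a n = rec_nat a (\<lambda>n r. if ev n then omega_after r else 2 ^ r) n" for ev a n
    by (induction n) simp_all
  then have comp: "computable (\<lambda>z. climb (event \<sigma> (nfst (nfst z))) (nsnd (nfst z)) (nsnd z))"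
    by (simp only:) (intro computable_intros decidable_event computable_omega_after)
  show "phi (climb_index \<sigma> i a) n = Some (climb (event \<sigma> i) a n)"
    unfolding climb_index_def by (subst smn_fun(2)[OF comp]) simp
  show "computable f \<Longrightarrow> computable g \<Longrightarrow> computable (\<lambda>x. climb_index \<sigma> (f x) (g x))"
    unfolding climb_index_def
    by (intro computable_comp[OF smn_fun(1)[OF comp]] computable_npair)
qed

primrec limit_seq :: "nat \<Rightarrow> nat \<Rightarrow> nat" where
  "limit_seq \<sigma> 0 = 1"
| "limit_seq \<sigma> (Suc i) = 3 * 5 ^ climb_index \<sigma> i (limit_seq \<sigma> i)"

lemma computable_limit_seq: "computable (limit_seq \<sigma>)"
proof -
  have "limit_seq \<sigma> = rec_nat 1 (\<lambda>i a. 3 * 5 ^ climb_index \<sigma> i a)"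
  proof
    show "limit_seq \<sigma> n = rec_nat 1 (\<lambda>i a. 3 * 5 ^ climb_index \<sigma> i a) n" for n
      by (induction n) simp_all
  qed
  moreover have "computable (\<lambda>n. rec_nat 1 (\<lambda>i a. 3 * 5 ^ climb_index \<sigma> i a) n)"
    by (intro computable_intros climb_index(2))
  ultimately show ?thesis by simp
qed

lemma finite_event: "finite {s. event \<sigma> i s}"
  by (rule finite_subset[OF _ finite_events[of i]]) (auto simp: event_def)

lemma final_height_Suc: "final_height \<sigma> (Suc i) = Suc (final_height \<sigma> i + card {s. event \<sigma> i s})"
proof -
  have "{s. act s \<and> side s = \<sigma> \<and> witness act s < Suc i} =
      {s. act s \<and> side s = \<sigma> \<and> witness act s < i} \<union> {s. event \<sigma> i s}"
    by (auto simp: event_def)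
  moreover have "card \<dots> = card {s. act s \<and> side s = \<sigma> \<and> witness act s < i} + card {s. event \<sigma> i s}"
    by (intro card_Un_disjoint finite_act_set finite_event) (auto simp: event_def)
  ultimately show ?thesis by (simp add: final_height_def)
qed

lemma lim_ht_limit_seq: "lim_ht (limit_seq \<sigma> i) (final_height \<sigma> i)"
proof (induction i)
  case 0
  have "final_height \<sigma> 0 = 0" by (simp add: final_height_def)
  then show ?case using lim_ht_0 by simp
next
  case (Suc i)
  show ?case
    unfolding final_height_Suc limit_seq.simps
    by (rule climb(1)[OF Suc finite_event climb_index(1)])
qed

lemma limit_seq_less: "2 ^ limit_seq \<sigma> i <\<^sub>O limit_seq \<sigma> (Suc i)"
  unfolding limit_seq.simps
  by (rule climb(2)[OF lim_ht_limit_seq finite_event climb_index(1)])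

lemma limit_notation:
  obtains a where "a \<in> Kleene_O" "ord_of a = omega_sq"
    "iter_jump Id a = direct_sum (\<lambda>i. jump (iter_jump Id (limit_seq \<sigma> i)))"
proof -
  have "computable (\<lambda>i. 2 ^ limit_seq \<sigma> i)"
    by (intro computable_intros computable_limit_seq)
  then obtain e where e: "\<And>i. phi e i = Some (2 ^ limit_seq \<sigma> i)" unfolding computable_def by blast
  have KO: "KO (limit_seq \<sigma> i)" for i by (rule KO_lim_ht[OF lim_ht_limit_seq])
  then have KO2: "KO (2 ^ limit_seq \<sigma> i)" for i by (rule KO_suc)
  have less: "2 ^ limit_seq \<sigma> i <\<^sub>O 2 ^ limit_seq \<sigma> (Suc i)" for i
    by (rule KO_less_trans[OF limit_seq_less KO_less_suc[OF KO]])
  have "ord_of (2 ^ limit_seq \<sigma> i) = oseg (final_height \<sigma> i) 1" for i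
    using ord_of_tower[OF KO ord_of_lim_ht[OF lim_ht_limit_seq], where n = 1] by simp
  then have "ord_of (3 * 5 ^ e) = omega_sq"
    unfolding ord_of_simps(3)[OF e KO2 less]
    by (rule ord_sup_eq_omega_sq) (simp add: final_height_def)
  moreover have "iter_jump Id (3 * 5 ^ e) = direct_sum (\<lambda>i. jump (iter_jump Id (limit_seq \<sigma> i)))"
    unfolding iter_jump_simps(3)[OF e KO2 less] by (simp add: iter_jump_simps(2) KO)
  moreover have "3 * 5 ^ e \<in> Kleene_O" unfolding Kleene_O_def using KO_lim[OF e KO2 less] by simp
  ultimately show ?thesis using that by blast
qed

theorem theorem1p11:
  shows "\<exists>a\<in>Kleene_O. \<exists>b\<in>Kleene_O. ord_of a = omega_sq \<and> ord_of b = omega_sq \<and>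
    \<not> iter_jump Id a \<le>\<^sub>c iter_jump Id b \<and> \<not> iter_jump Id b \<le>\<^sub>c iter_jump Id a"
proof -
  obtain a where a: "a \<in> Kleene_O" "ord_of a = omega_sq"
    "iter_jump Id a = direct_sum (\<lambda>i. jump (iter_jump Id (limit_seq 0 i)))"
    by (rule limit_notation)
  obtain b where b: "b \<in> Kleene_O" "ord_of b = omega_sq"
    "iter_jump Id b = direct_sum (\<lambda>i. jump (iter_jump Id (limit_seq 1 i)))"
    by (rule limit_notation)
  have "\<not> iter_jump Id a \<le>\<^sub>c iter_jump Id b"
    unfolding a b
    by (rule not_reducible_direct_sum_lim_ht[OF lim_ht_limit_seq lim_ht_limit_seq])
      (use final_height_not_dominated[of _ 0] in simp)
  moreover have "\<not> iter_jump Id b \<le>\<^sub>c iter_jump Id a"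
    unfolding a b
    by (rule not_reducible_direct_sum_lim_ht[OF lim_ht_limit_seq lim_ht_limit_seq])
      (use final_height_not_dominated[of _ 1] in simp)
  ultimately show ?thesis using a b by blast
qed

end
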